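(* Let $f:M(\mathbb{T})\to l^{\infty}(\mathbb{Z})$ be the homomorphism $f(\mu)=(\widehat{\mu}(n))_{n=-\infty}^{\infty}$. Then the dual mapping $f^{*}:\mathfrak{M}(l^{\infty}(\mathbb{Z}))=\beta\mathbb{Z}\to\mathfrak{M}(M(\mathbb{T}))$ is not injective.
   Context: $\mathbb{T}$ is the circle group (identified with $\mathbb{R}/2\pi\mathbb{Z}$). $M(\mathbb{T})$ is the commutative unital Banach algebra of complex regular Borel measures on $\mathbb{T}$, with convolution as multiplication, the total variation norm, and unit $\delta_0$. For $\mu\in M(\mathbb{T})$ and $n\in\mathbb{Z}$, $\widehat{\mu}(n)=\int_0^{2\pi}e^{-int}\,d\mu(t)$ is the $n$-th Fourier–Stieltjes coefficient. $l^{\infty}(\mathbb{Z})$ is the Banach algebra of bounded complex sequences indexed by $\mathbb{Z}$ with pointwise operations and sup norm. For a commutative unital complex Banach algebra $A$, $\mathfrak{M}(A)$ is the set of nonzero multiplicative linear functionals on $A$ with the weak$^*$ topology; $\mathfrak{M}(l^{\infty}(\mathbb{Z}))$ is identified with $\beta\mathbb{Z}$, the Stone–Čech compactification of the discrete space $\mathbb{Z}$. The dual mapping is defined by $f^{*}(\varphi)(\mu)=\varphi(f(\mu))$ for $\varphi\in\mathfrak{M}(l^{\infty}(\mathbb{Z}))$ and $\mu\in M(\mathbb{T})$. *)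

theory Defs
  imports "HOL-Analysis.Analysis" "HOL-Algebra.Module"
begin

section \<open>Complex measures\<close>

text \<open>
  A complex measure on the measurable space \<open>M\<close> is a countably additive complex function on
  \<open>sets M\<close>. The value is fixed to be 0 off \<open>sets M\<close>, so that equality of set functions is
  equality of measures. That the empty set has measure 0 follows from convergence of the series
  for the constant empty family. Only the \<open>\<sigma>\<close>-algebra of \<open>M\<close> is used.
\<close>

definition complex_measure :: "'a measure \<Rightarrow> ('a set \<Rightarrow> complex) \<Rightarrow> bool" where
  "complex_measure M \<mu> \<longleftrightarrow>
     (\<forall>A :: nat \<Rightarrow> 'a set. range A \<subseteq> sets M \<longrightarrow> disjoint_family A \<longrightarrow>
        (\<lambda>n. \<mu> (A n)) sums \<mu> (\<Union>n. A n)) \<and>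
     (\<forall>E. E \<notin> sets M \<longrightarrow> \<mu> E = 0)"

definition total_variation :: "'a measure \<Rightarrow> ('a set \<Rightarrow> complex) \<Rightarrow> 'a set \<Rightarrow> ennreal" where
  "total_variation M \<mu> E =
     (SUP A \<in> {A :: nat \<Rightarrow> 'a set. range A \<subseteq> sets M \<and> disjoint_family A \<and> (\<Union>n. A n) = E}.
        \<Sum>n. ennreal (cmod (\<mu> (A n))))"

text \<open>
  The positive part \<open>\<rho>\<^sup>+(E) = sup {\<rho>(B) | B \<subseteq> E}\<close> of the Jordan decomposition of a finite signed
  measure \<open>\<rho>\<close>; the negative part is the positive part of \<open>-\<rho>\<close>. The function \<open>ennreal\<close> maps
  negative values to 0, which is harmless because \<open>B = {}\<close> already contributes 0.
\<close>

definition pos_variation :: "'a measure \<Rightarrow> ('a set \<Rightarrow> real) \<Rightarrow> 'a measure" where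
  "pos_variation M \<rho> =
     measure_of (space M) (sets M) (\<lambda>E. SUP B \<in> {B \<in> sets M. B \<subseteq> E}. ennreal (\<rho> B))"

definition complex_integral ::
    "'a measure \<Rightarrow> ('a set \<Rightarrow> complex) \<Rightarrow> ('a \<Rightarrow> complex) \<Rightarrow> complex" where
  "complex_integral M \<mu> g =
     ((\<integral>x. g x \<partial>pos_variation M (\<lambda>E. Re (\<mu> E))) - (\<integral>x. g x \<partial>pos_variation M (\<lambda>E. - Re (\<mu> E)))) +
     \<i> * ((\<integral>x. g x \<partial>pos_variation M (\<lambda>E. Im (\<mu> E))) - (\<integral>x. g x \<partial>pos_variation M (\<lambda>E. - Im (\<mu> E))))"


section \<open>The measure algebra of the circle group\<close>

text \<open>
  The circle group is realised as the multiplicative group of complex numbers of modulus 1;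
  the class of \<open>t\<close> modulo \<open>2\<pi>\<close> corresponds to \<open>exp (\<i> * t)\<close>, and the neutral element 0 to 1.
\<close>

definition circle_borel :: "complex measure" where
  "circle_borel = restrict_space borel (sphere 0 1)"

definition regular_circle_measure :: "(complex set \<Rightarrow> complex) \<Rightarrow> bool" where
  "regular_circle_measure \<mu> \<longleftrightarrow>
     (\<forall>E \<in> sets circle_borel.
        total_variation circle_borel \<mu> E =
          (INF U \<in> {U. openin (top_of_set (sphere 0 1)) U \<and> E \<subseteq> U}. total_variation circle_borel \<mu> U) \<and>
        total_variation circle_borel \<mu> E =
          (SUP K \<in> {K. compact K \<and> K \<subseteq> E}. total_variation circle_borel \<mu> K))"

text \<open>
  \<open>(\<mu> * \<nu>)(E) = \<integral> \<mu>(E t\<inverse>) d\<nu>(t)\<close>, which is the product measure of the set of all \<open>(s, t)\<close>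
  with \<open>s t \<in> E\<close>.
\<close>

definition circle_convolution ::
    "(complex set \<Rightarrow> complex) \<Rightarrow> (complex set \<Rightarrow> complex) \<Rightarrow> complex set \<Rightarrow> complex" where
  "circle_convolution \<mu> \<nu> =
     (\<lambda>E. if E \<in> sets circle_borel
          then complex_integral circle_borel \<nu> (\<lambda>t. \<mu> {s \<in> sphere 0 1. s * t \<in> E})
          else 0)"

definition circle_dirac :: "complex \<Rightarrow> complex set \<Rightarrow> complex" where
  "circle_dirac z = (\<lambda>E. if E \<in> sets circle_borel \<and> z \<in> E then 1 else 0)"

definition circle_measure_algebra :: "(complex, complex set \<Rightarrow> complex) module" where
  "circle_measure_algebra =
     \<lparr>carrier = {\<mu>. complex_measure circle_borel \<mu> \<and> regular_circle_measure \<mu>},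
      mult = circle_convolution,
      one = circle_dirac 1,
      zero = (\<lambda>E. 0),
      add = (\<lambda>\<mu> \<nu> E. \<mu> E + \<nu> E),
      smult = (\<lambda>c \<mu> E. c * \<mu> E)\<rparr>"

text \<open>With \<open>z = exp (\<i> * t)\<close>, the integrand \<open>exp (- \<i> * n * t)\<close> is \<open>z powi (- n)\<close>.\<close>

definition fourier_stieltjes :: "(complex set \<Rightarrow> complex) \<Rightarrow> int \<Rightarrow> complex" where
  "fourier_stieltjes \<mu> n = complex_integral circle_borel \<mu> (\<lambda>z. z powi (- n))"


section \<open>Bounded two-sided sequences\<close>

definition linf_int :: "(complex, int \<Rightarrow> complex) module" where
  "linf_int =
     \<lparr>carrier = {x. bounded (range x)},
      mult = (\<lambda>x y n. x n * y n),
      one = (\<lambda>n. 1),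
      zero = (\<lambda>n. 0),
      add = (\<lambda>x y n. x n + y n),
      smult = (\<lambda>c x n. c * x n)\<rparr>"


section \<open>Multiplicative functionals and dual mappings\<close>

definition algebra_hom ::
    "(complex, 'a) module \<Rightarrow> (complex, 'b) module \<Rightarrow> ('a \<Rightarrow> 'b) set" where
  "algebra_hom A B =
     {f \<in> ring_hom A B. \<forall>c. \<forall>x \<in> carrier A. f (c \<odot>\<^bsub>A\<^esub> x) = c \<odot>\<^bsub>B\<^esub> f x}"

text \<open>
  Functionals on \<open>A\<close> are represented by functions extensional on the carrier, so that equality
  of functions is equality of functionals.
\<close>

definition characters :: "(complex, 'a) module \<Rightarrow> ('a \<Rightarrow> complex) set" where
  "characters A =
     {\<phi> \<in> extensional (carrier A).
        (\<forall>x \<in> carrier A. \<forall>y \<in> carrier A. \<phi> (x \<oplus>\<^bsub>A\<^esub> y) = \<phi> x + \<phi> y) \<and>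
        (\<forall>c. \<forall>x \<in> carrier A. \<phi> (c \<odot>\<^bsub>A\<^esub> x) = c * \<phi> x) \<and>
        (\<forall>x \<in> carrier A. \<forall>y \<in> carrier A. \<phi> (x \<otimes>\<^bsub>A\<^esub> y) = \<phi> x * \<phi> y) \<and>
        (\<exists>x \<in> carrier A. \<phi> x \<noteq> 0)}"

definition dual_map ::
    "(complex, 'a) module \<Rightarrow> ('a \<Rightarrow> 'b) \<Rightarrow> ('b \<Rightarrow> complex) \<Rightarrow> 'a \<Rightarrow> complex" where
  "dual_map A f \<phi> = (\<lambda>x \<in> carrier A. \<phi> (f x))"

end

theory Submission imports Defs begin

text \<open>
  Let \<open>\<Lambda>\<close> be a limit along a free ultrafilter on the natural numbers. The iterated limits
  \<open>\<phi>(x) = \<Lambda>\<^sub>m \<Lambda>\<^sub>n x(n - m)\<close> and \<open>\<psi>(x) = \<Lambda>\<^sub>m \<Lambda>\<^sub>n x(m - n)\<close> are characters of the bounded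
  sequences, and they differ on the indicator of the positive integers. They agree on all
  Fourier-Stieltjes transforms: by linearity it suffices to treat a positive measure, whose
  transform \<open>a\<close> is positive definite. Then \<open>a(-n)\<close> is the conjugate of \<open>a(n)\<close>, so \<open>\<psi>(a)\<close> is
  the conjugate of \<open>L = \<phi>(a)\<close> and it remains to see that \<open>L\<close> is real. One can choose arbitrarily
  long finite sequences \<open>s\<close> with \<open>a(s\<^sub>j - s\<^sub>i)\<close> close to \<open>L\<close> for all \<open>i < j\<close>; positive definiteness
  with coefficient 1 on the first half of \<open>s\<close> and \<open>-(1 + it)\<close> on the second half gives
  \<open>t\<^sup>2 Re L - 2t Im L \<ge> 0\<close> for every real \<open>t\<close>, hence \<open>Im L = 0\<close>.
\<close>

section \<open>Signed and complex measures\<close>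

text \<open>Renaming the variables turns \<open>\<psi>(x)\<close> into the limit of
  \<open>x(n - m)\<close> with \<open>m\<close> inside and \<open>n\<close> outside, so the two
  characters differ only in the order of two limits. In the semigroup of the Stone-Cech
  compactification they are the sums, in opposite orders, of a free ultrafilter and its reflection.
  The point is therefore that transforms of measures admit the exchange of double limits (Eberlein's
  weak almost periodicity), while the indicator of a half line does not. The coefficients come from
  a perturbation: with 1 and -1 the form cancels to leading order, and turning -1 by
  \<open>it\<close> brings in \<open>Im L\<close> to first order but \<open>Re L\<close> only to
  second, so a small \<open>t\<close> of the right sign would make the form negative unless
  \<open>Im L = 0\<close>. On the side of measures the obstacle is that the integral is defined
  through Jordan parts, which are not additive in the measure. Linearity and multiplicativity of the
  transform are obtained by showing that any representation by finite positive measures gives the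
  same integral.\<close>

definition signed_measure :: "'a measure \<Rightarrow> ('a set \<Rightarrow> real) \<Rightarrow> bool" where
  "signed_measure M \<rho> \<longleftrightarrow>
     (\<forall>A :: nat \<Rightarrow> 'a set. range A \<subseteq> sets M \<longrightarrow> disjoint_family A \<longrightarrow>
        (\<lambda>n. \<rho> (A n)) sums \<rho> (\<Union>n. A n))"

lemma signed_measureD:
  "signed_measure M \<rho> \<Longrightarrow> range A \<subseteq> sets M \<Longrightarrow> disjoint_family A \<Longrightarrow> (\<lambda>n. \<rho> (A n)) sums \<rho> (\<Union>n. A n)"
  by (simp add: signed_measure_def)

lemma signed_measure_uminus: "signed_measure M \<rho> \<Longrightarrow> signed_measure M (\<lambda>E. - \<rho> E)"
  by (simp add: signed_measure_def sums_minus)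

lemma signed_measure_empty: "signed_measure M \<rho> \<Longrightarrow> \<rho> {} = 0"
  using signed_measureD[of M \<rho> "\<lambda>_. {}"] by (auto simp: sums_iff disjoint_family_on_def summable_const_iff)

lemma signed_measure_Un:
  assumes "signed_measure M \<rho>" "A \<in> sets M" "B \<in> sets M" "A \<inter> B = {}"
  shows "\<rho> (A \<union> B) = \<rho> A + \<rho> B"
proof -
  have "(\<lambda>n. \<rho> (binaryset A B n)) sums \<rho> (\<Union>n. binaryset A B n)"
    using assms(2-) by (intro signed_measureD[OF assms(1)])
      (auto simp: range_binaryset_eq disjoint_family_on_def binaryset_def)
  then have "(\<lambda>n. \<rho> (binaryset A B n)) sums \<rho> (A \<union> B)"
    by (simp add: UN_binaryset_eq)
  moreover have "(\<lambda>n. \<rho> (binaryset A B n)) sums (\<rho> A + \<rho> B)"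
    by (rule binaryset_sums) (rule signed_measure_empty[OF assms(1)])
  ultimately show ?thesis by (rule sums_unique2)
qed

lemma signed_measure_Diff:
  assumes "signed_measure M \<rho>" "A \<in> sets M" "B \<in> sets M" "B \<subseteq> A"
  shows "\<rho> (A - B) = \<rho> A - \<rho> B"
proof -
  have "\<rho> (B \<union> (A - B)) = \<rho> B + \<rho> (A - B)"
    using assms by (intro signed_measure_Un) auto
  moreover have "B \<union> (A - B) = A" using assms(4) by blast
  ultimately show ?thesis by simp
qed

text \<open>
  If \<open>\<rho>\<close> were unbounded, one could split off, again and again, a set on which \<open>\<bar>\<rho>\<bar> \<ge> 1\<close> such that
  \<open>\<rho>\<close> is still unbounded on the remainder; this contradicts convergence of the series.
\<close>

lemma signed_measure_bounded:
  assumes \<rho>: "signed_measure M \<rho>"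
  shows "\<exists>C. \<forall>B\<in>sets M. \<bar>\<rho> B\<bar> \<le> C"
proof (rule ccontr)
  define bdd where "bdd E \<longleftrightarrow> (\<exists>C. \<forall>B\<in>sets M. B \<subseteq> E \<longrightarrow> \<bar>\<rho> B\<bar> \<le> C)" for E
  assume "\<not> ?thesis"
  then have top: "\<not> bdd (space M)"
    unfolding bdd_def by (meson sets.sets_into_space)
  have step: "\<exists>E'. (E' \<in> sets M \<and> \<not> bdd E') \<and> (E' \<subseteq> E \<and> 1 \<le> \<bar>\<rho> (E - E')\<bar>)"
    if E: "E \<in> sets M \<and> \<not> bdd E" for E
  proof -
    \<comment> \<open>The threshold forces both \<open>\<rho> B\<close> and
      \<open>\<rho> (E - B)\<close> to have modulus at least 1, so whichever half is unbounded can
      be kept and the other split off.\<close>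
    obtain B where B: "B \<in> sets M" "B \<subseteq> E" "\<bar>\<rho> B\<bar> > 1 + \<bar>\<rho> E\<bar>"
      using E unfolding bdd_def by (meson not_le)
    have diff: "\<rho> (E - B) = \<rho> E - \<rho> B" using E B \<rho> by (intro signed_measure_Diff) auto
    show ?thesis
    proof (cases "bdd B")
      case False
      then show ?thesis using B diff by (intro exI[of _ B]) auto
    next
      case True
      have "\<not> bdd (E - B)"
      proof
        assume "bdd (E - B)"
        then obtain C1 C2 where C: "\<And>F. F \<in> sets M \<Longrightarrow> F \<subseteq> B \<Longrightarrow> \<bar>\<rho> F\<bar> \<le> C1"
          "\<And>F. F \<in> sets M \<Longrightarrow> F \<subseteq> E - B \<Longrightarrow> \<bar>\<rho> F\<bar> \<le> C2"
          using True unfolding bdd_def by meson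
        have "\<bar>\<rho> F\<bar> \<le> C1 + C2" if F: "F \<in> sets M" "F \<subseteq> E" for F
        proof -
          have "\<rho> ((F \<inter> B) \<union> (F - B)) = \<rho> (F \<inter> B) + \<rho> (F - B)"
            using F B by (intro signed_measure_Un[OF \<rho>]) auto
          moreover have "(F \<inter> B) \<union> (F - B) = F" by blast
          moreover have "\<bar>\<rho> (F \<inter> B)\<bar> \<le> C1" using F B by (intro C) auto
          moreover have "\<bar>\<rho> (F - B)\<bar> \<le> C2" using F B by (intro C) auto
          ultimately show ?thesis by simp
        qed
        then show False using E unfolding bdd_def by blast
      qed
      moreover have "E - (E - B) = B" using B(2) by blast
      ultimately show ?thesis using E B by (intro exI[of _ "E - B"]) auto
    qed
  qed
  obtain E where E: "\<And>n. E n \<in> sets M" "\<And>n. E (Suc n) \<subseteq> E n" "\<And>n :: nat. 1 \<le> \<bar>\<rho> (E n - E (Suc n))\<bar>"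
    using dependent_nat_choice[of "\<lambda>_ E. E \<in> sets M \<and> \<not> bdd E"
        "\<lambda>_ E E'. E' \<subseteq> E \<and> 1 \<le> \<bar>\<rho> (E - E')\<bar>"] step top by (metis sets.top)
  have "decseq E" using E(2) by (simp add: decseq_Suc_iff)
  then have "(E m - E (Suc m)) \<inter> (E n - E (Suc n)) = {}" if "m < n" for m n
    using that decseqD[of E "Suc m" n] by auto
  then have "disjoint_family (\<lambda>n. E n - E (Suc n))"
    unfolding disjoint_family_on_def by (metis Int_commute linorder_neqE_nat)
  then have "(\<lambda>n. \<rho> (E n - E (Suc n))) sums \<rho> (\<Union>n. E n - E (Suc n))"
    using E(1) by (intro signed_measureD[OF \<rho>]) auto
  then have "(\<lambda>n. \<rho> (E n - E (Suc n))) \<longlonglongrightarrow> 0"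
    by (intro summable_LIMSEQ_zero) (rule sums_summable)
  from LIMSEQ_D[OF this, of 1] obtain n where "\<bar>\<rho> (E n - E (Suc n))\<bar> < 1" by auto
  with E(3)[of n] show False by simp
qed

lemma space_pos_variation [simp]: "space (pos_variation M \<rho>) = space M"
  by (simp add: pos_variation_def space_measure_of sets.space_closed)

lemma sets_pos_variation [simp]: "sets (pos_variation M \<rho>) = sets M"
  by (simp add: pos_variation_def)

text \<open>\<open>measure_of\<close> falls back to the zero measure unless its argument is a
  measure, so countable additivity of the supremum must be proved. Superadditivity comes from
  uniting a subset of \<open>A\<close> with one of \<open>B\<close>; the converse from cutting a
  subset of the union along the pieces.\<close>

lemma emeasure_pos_variation:
  assumes \<rho>: "signed_measure M \<rho>" and "E \<in> sets M"
  shows "emeasure (pos_variation M \<rho>) E = (SUP B \<in> {B \<in> sets M. B \<subseteq> E}. ennreal (\<rho> B))"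
proof -
  define V where "V E = (SUP B \<in> {B \<in> sets M. B \<subseteq> E}. ennreal (\<rho> B))" for E
  have upper: "ennreal (\<rho> B) \<le> V E" if "B \<in> sets M" "B \<subseteq> E" for B E
    unfolding V_def using that by (intro SUP_upper) auto
  have superadd: "V A + V B \<le> V (A \<union> B)" if AB: "A \<in> sets M" "B \<in> sets M" "A \<inter> B = {}" for A B
  proof -
    have "ennreal (\<rho> C) + ennreal (\<rho> D) \<le> V (A \<union> B)"
      if C: "C \<in> sets M" "C \<subseteq> A" and D: "D \<in> sets M" "D \<subseteq> B" for C D
    \<comment> \<open>A nonpositive value is truncated to 0 by \<open>ennreal\<close>, and then the
      other set alone witnesses the bound; otherwise truncation does nothing and additivity
      applies.\<close>
    proof (cases "\<rho> C \<le> 0 \<or> \<rho> D \<le> 0")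
      case True
      then show ?thesis
        using upper[of C "A \<union> B"] upper[of D "A \<union> B"] C D
        by (metis ennreal_neg add_0 add.right_neutral le_supI1 le_supI2)
    next
      case False
      then have "ennreal (\<rho> C) + ennreal (\<rho> D) = ennreal (\<rho> (C \<union> D))"
        using C D AB(3) by (subst signed_measure_Un[OF \<rho>]) auto
      then show ?thesis using C D by (auto intro!: upper)
    qed
    then have "ennreal (\<rho> C) + V B \<le> V (A \<union> B)" if "C \<in> sets M" "C \<subseteq> A" for C
      unfolding V_def[of B] using that
      by (subst ennreal_SUP_add_right) (auto intro!: SUP_least)
    then show ?thesis
      unfolding V_def[of A]
      by (subst ennreal_SUP_add_left[symmetric]) (auto intro!: SUP_least)
  qed
  have "countably_additive (sets M) V"
  proof (rule countably_additiveI)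
    fix A :: "nat \<Rightarrow> 'a set"
    assume A: "range A \<subseteq> sets M" "disjoint_family A"
    show "(\<Sum>n. V (A n)) = V (\<Union>n. A n)"
    proof (rule antisym)
      have "(\<Sum>i<n. V (A i)) \<le> V (\<Union>i<n. A i)" for n
      proof (induction n)
        case (Suc n)
        have "A n \<inter> A i = {}" if "i < n" for i
          using A(2) that by (auto simp: disjoint_family_on_def)
        then have "V (\<Union>i<n. A i) + V (A n) \<le> V ((\<Union>i<n. A i) \<union> A n)"
          using A(1) by (intro superadd) auto
        with Suc show ?case
          by (simp add: lessThan_Suc Un_commute add.commute[of "V (A n)"])
            (meson add_right_mono order_trans)
      qed simp
      also have "V (\<Union>i<n. A i) \<le> V (\<Union>n. A n)" for n
        unfolding V_def by (intro SUP_subset_mono) auto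
      finally show "(\<Sum>n. V (A n)) \<le> V (\<Union>n. A n)"
        by (intro suminf_le_const) auto
      show "V (\<Union>n. A n) \<le> (\<Sum>n. V (A n))"
        unfolding V_def[of "\<Union>n. A n"]
      proof (rule SUP_least)
        fix B assume B: "B \<in> {B \<in> sets M. B \<subseteq> (\<Union>n. A n)}"
        have "(\<lambda>n. \<rho> (B \<inter> A n)) sums \<rho> (\<Union>n. B \<inter> A n)"
          using A B by (intro signed_measureD[OF \<rho>]) (auto simp: disjoint_family_on_def)
        moreover have "(\<Union>n. B \<inter> A n) = B" using B by blast
        ultimately have "(\<lambda>n. ennreal (\<Sum>i<n. \<rho> (B \<inter> A i))) \<longlonglongrightarrow> ennreal (\<rho> B)"
          unfolding sums_def by (intro tendsto_ennrealI) simp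
        moreover have "ennreal (\<Sum>i<n. \<rho> (B \<inter> A i)) \<le> (\<Sum>n. V (A n))" for n
        proof -
          \<comment> \<open>Terms of either sign occur, and truncation at 0 is only subadditive;
            this is the direction used.\<close>
          have "ennreal (\<Sum>i<n. \<rho> (B \<inter> A i)) \<le> (\<Sum>i<n. ennreal (\<rho> (B \<inter> A i)))"
          proof (induction n)
            case (Suc n)
            have "ennreal (a + b) \<le> ennreal a + ennreal b" for a b
              by (cases "a \<ge> 0"; cases "b \<ge> 0")
                (auto simp: ennreal_neg simp flip: ennreal_plus intro!: ennreal_leI)
            then show ?case using Suc by (simp add: lessThan_Suc) (meson add_left_mono order_trans)
          qed simp
          also have "\<dots> \<le> (\<Sum>i<n. V (A i))"
            using A B by (intro sum_mono upper) auto
          also have "\<dots> \<le> (\<Sum>n. V (A n))" by (rule sum_le_suminf) auto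
          finally show ?thesis .
        qed
        ultimately show "ennreal (\<rho> B) \<le> (\<Sum>n. V (A n))"
          by (intro LIMSEQ_le_const2) auto
      qed
    qed
  qed
  moreover have "positive (sets M) V"
    using signed_measure_empty[OF \<rho>] by (auto simp: positive_def V_def)
  ultimately have "emeasure (measure_of (space M) (sets M) V) E = V E"
    by (intro emeasure_measure_of_sigma sets.sigma_algebra_axioms assms(2))
  moreover have "pos_variation M \<rho> = measure_of (space M) (sets M) V"
    unfolding pos_variation_def V_def by (rule refl)
  ultimately show ?thesis by (simp only: V_def)
qed

text \<open>For \<open>B \<subseteq> E\<close>, \<open>\<rho> B = \<rho> E - \<rho> (E - B)\<close>
  is at most \<open>\<rho> E\<close> plus the negative part of \<open>E\<close>. The supremum over
  \<open>B\<close> gives one inequality of the Jordan decomposition, and the same argument for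
  \<open>- \<rho>\<close> the other.\<close>

lemma
  assumes \<rho>: "signed_measure M \<rho>"
  shows finite_measure_pos_variation: "finite_measure (pos_variation M \<rho>)"
    and measure_pos_variation_diff: "E \<in> sets M \<Longrightarrow>
      measure (pos_variation M \<rho>) E - measure (pos_variation M (\<lambda>E. - \<rho> E)) E = \<rho> E"
proof -
  have fin: "finite_measure (pos_variation M \<rho>)" if \<rho>: "signed_measure M \<rho>" for \<rho>
  proof
    obtain C where "\<And>B. B \<in> sets M \<Longrightarrow> \<rho> B \<le> C"
      using signed_measure_bounded[OF \<rho>] by (meson abs_le_D1)
    then have "emeasure (pos_variation M \<rho>) (space M) \<le> ennreal C"
      using \<rho> by (auto simp: emeasure_pos_variation intro!: SUP_least ennreal_leI)
    then show "emeasure (pos_variation M \<rho>) (space (pos_variation M \<rho>)) \<noteq> \<infinity>"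
      using ennreal_less_top[of C] by (auto simp: top_unique)
  qed
  show "finite_measure (pos_variation M \<rho>)" by (rule fin[OF \<rho>])
  show "measure (pos_variation M \<rho>) E - measure (pos_variation M (\<lambda>E. - \<rho> E)) E = \<rho> E"
    if E: "E \<in> sets M"
  proof -
    have le: "measure (pos_variation M \<rho>) E \<le> \<rho> E + measure (pos_variation M (\<lambda>E. - \<rho> E)) E"
      if \<rho>: "signed_measure M \<rho>" for \<rho>
    proof -
      interpret P: finite_measure "pos_variation M \<rho>" by (rule fin[OF \<rho>])
      interpret N: finite_measure "pos_variation M (\<lambda>E. - \<rho> E)"
        by (rule fin[OF signed_measure_uminus[OF \<rho>]])
      let ?n = "measure (pos_variation M (\<lambda>E. - \<rho> E)) E"
      have n: "- \<rho> B \<le> ?n" if "B \<in> sets M" "B \<subseteq> E" for B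
      proof -
        have "ennreal (- \<rho> B) \<le> emeasure (pos_variation M (\<lambda>E. - \<rho> E)) E"
          using that E by (subst emeasure_pos_variation[OF signed_measure_uminus[OF \<rho>]])
            (auto intro: SUP_upper)
        then show ?thesis by (simp add: N.emeasure_eq_measure)
      qed
      have "\<rho> B \<le> \<rho> E + ?n" if B: "B \<in> sets M" "B \<subseteq> E" for B
        using n[of "E - B"] signed_measure_Diff[OF \<rho> E B] B E by auto
      then have "emeasure (pos_variation M \<rho>) E \<le> ennreal (\<rho> E + ?n)"
        using E by (subst emeasure_pos_variation[OF \<rho>]) (auto intro!: SUP_least ennreal_leI)
      moreover have "0 \<le> \<rho> E + ?n" using n[of E] E by simp
      ultimately show ?thesis by (simp add: P.emeasure_eq_measure)
    qed
    show ?thesis using le[OF \<rho>] le[OF signed_measure_uminus[OF \<rho>]] by simp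
  qed
qed

text \<open>The factor \<open>c\<close> treats the real and imaginary parts and their negatives at
  once.\<close>

lemma signed_measure_Re:
  assumes "complex_measure M \<mu>"
  shows "signed_measure M (\<lambda>E. Re (c * \<mu> E))"
  using assms unfolding signed_measure_def complex_measure_def
  by (intro allI impI sums_Re sums_mult) simp

section \<open>Complex measures as combinations of finite positive measures\<close>

text \<open>Unlike Jordan decompositions, such representations are closed under sums, scalar
  multiples and convolution. The free index type lets disjoint sums and products of index sets serve
  as new index sets.\<close>

definition measure_combination ::
    "'a measure \<Rightarrow> 'i set \<Rightarrow> ('i \<Rightarrow> complex) \<Rightarrow> ('i \<Rightarrow> 'a measure) \<Rightarrow> ('a set \<Rightarrow> complex) \<Rightarrow> bool" where
  "measure_combination M I c m \<mu> \<longleftrightarrow> finite I \<and>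
     (\<forall>i\<in>I. finite_measure (m i) \<and> sets (m i) = sets M) \<and>
     (\<forall>E\<in>sets M. \<mu> E = (\<Sum>i\<in>I. c i * measure (m i) E))"

text \<open>
  For \<open>k = 0, 1, 2, 3\<close> these are the positive variations of \<open>Re \<mu>\<close>, \<open>Im \<mu>\<close>, \<open>- Re \<mu>\<close>, \<open>- Im \<mu>\<close>,
  so that \<open>\<mu>\<close> is the sum of \<open>\<i>\<^sup>k\<close> times the \<open>k\<close>-th part.
\<close>

definition jordan_part :: "'a measure \<Rightarrow> ('a set \<Rightarrow> complex) \<Rightarrow> nat \<Rightarrow> 'a measure" where
  "jordan_part M \<mu> k = pos_variation M (\<lambda>E. Re (cnj (\<i> ^ k) * \<mu> E))"

lemma sum_power_i_lessThan_4:
  "(\<Sum>k<4. \<i> ^ k * f k) = (f 0 - f 2) + \<i> * (f 1 - f (3 :: nat))"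
proof -
  have "{..<4 :: nat} = {0, 1, 2, 3}" by auto
  then show ?thesis by (simp add: power3_eq_cube right_diff_distrib)
qed

lemma jordan_part_simps:
  "jordan_part M \<mu> 0 = pos_variation M (\<lambda>E. Re (\<mu> E))"
  "jordan_part M \<mu> 1 = pos_variation M (\<lambda>E. Im (\<mu> E))"
  "jordan_part M \<mu> 2 = pos_variation M (\<lambda>E. - Re (\<mu> E))"
  "jordan_part M \<mu> 3 = pos_variation M (\<lambda>E. - Im (\<mu> E))"
  by (simp_all add: jordan_part_def power3_eq_cube)

lemma measure_combination_jordan:
  assumes "complex_measure M \<mu>"
  shows "measure_combination M {..<4} (\<lambda>k. \<i> ^ k) (jordan_part M \<mu>) \<mu>"
proof -
  have "finite_measure (jordan_part M \<mu> k)" for k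
    unfolding jordan_part_def by (intro finite_measure_pos_variation signed_measure_Re assms)
  moreover have "\<mu> E = (\<Sum>k<4. \<i> ^ k * measure (jordan_part M \<mu> k) E)" if "E \<in> sets M" for E
    using measure_pos_variation_diff[OF signed_measure_Re[OF assms, of 1] that]
      measure_pos_variation_diff[OF signed_measure_Re[OF assms, of "-\<i>"] that]
    by (simp add: sum_power_i_lessThan_4 jordan_part_simps[unfolded One_nat_def] complex_eq_iff)
  moreover have "sets (jordan_part M \<mu> k) = sets M" for k
    by (simp add: jordan_part_def)
  ultimately show ?thesis
    unfolding measure_combination_def by (intro conjI ballI finite_lessThan) simp_all
qed

lemma complex_integral_jordan:
  "complex_integral M \<mu> g = (\<Sum>k<4. \<i> ^ k * (\<integral>x. g x \<partial>jordan_part M \<mu> k))"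
  by (simp only: sum_power_i_lessThan_4 jordan_part_simps complex_integral_def)

text \<open>For a simple function the sum can be regrouped by values, and the coefficient of each
  value is the vanishing set function at a level set. Dominated convergence passes to bounded
  \<open>g\<close>.\<close>

lemma sum_integral_eq_0:
  fixes g :: "'a \<Rightarrow> complex"
  assumes "finite I"
    and m: "\<And>i. i \<in> I \<Longrightarrow> finite_measure (m i)" "\<And>i. i \<in> I \<Longrightarrow> sets (m i) = sets M"
    and 0: "\<And>E. E \<in> sets M \<Longrightarrow> (\<Sum>i\<in>I. c i * complex_of_real (measure (m i) E)) = 0"
    and g: "g \<in> borel_measurable M" "\<And>x. x \<in> space M \<Longrightarrow> cmod (g x) \<le> C"
  shows "(\<Sum>i\<in>I. c i * (\<integral>x. g x \<partial>m i)) = 0"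
proof -
  \<comment> \<open>Approximating relative to the base point 0 yields the factor 2, hence the
    constant dominating function \<open>2 * C\<close>.\<close>
  obtain F where F: "\<And>n. simple_function M (F n)" "\<And>x. x \<in> space M \<Longrightarrow> (\<lambda>n. F n x) \<longlonglongrightarrow> g x"
    "\<And>n x. x \<in> space M \<Longrightarrow> cmod (F n x) \<le> 2 * cmod (g x)"
    using borel_measurable_implies_sequence_metric[OF g(1), of 0] unfolding dist_0_norm
    by (metis dist_norm diff_zero)
  have sp: "space (m i) = space M" if "i \<in> I" for i
    using m(2)[OF that] by (rule sets_eq_imp_space_eq)
  have "(\<Sum>i\<in>I. c i * (\<integral>x. F n x \<partial>m i)) = 0" for n
  proof -
    have fin: "finite (F n ` space M)" using F(1) by (rule simple_functionD)
    have meas: "{x \<in> space M. F n x = y} \<in> sets M" for y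
      using simple_functionD(2)[OF F(1)[of n], of "{y}"] by (simp add: vimage_def Int_def conj_commute[of "_ \<in> space M"])
    have "(\<integral>x. F n x \<partial>m i) = (\<Sum>y\<in>F n ` space M. measure (m i) {x\<in>space M. F n x = y} *\<^sub>R y)"
      if i: "i \<in> I" for i
    proof -
      interpret finite_measure "m i" by (rule m(1)[OF i])
      have "simple_function (m i) (F n)"
        using F(1)[of n] by (simp add: simple_function_def sp[OF i] m(2)[OF i])
      then have "Bochner_Integration.simple_bochner_integrable (m i) (F n)"
        by (simp add: simple_bochner_integrable.simps)
      then show ?thesis
        by (subst simple_bochner_integrable_eq_integral[symmetric])
          (simp_all add: simple_bochner_integral_def sp[OF i])
    qed
    then have "(\<Sum>i\<in>I. c i * (\<integral>x. F n x \<partial>m i))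
      = (\<Sum>i\<in>I. \<Sum>y\<in>F n ` space M. c i * complex_of_real (measure (m i) {x\<in>space M. F n x = y}) * y)"
      by (simp add: sum_distrib_left scaleR_conv_of_real mult.assoc)
    also have "\<dots> = (\<Sum>y\<in>F n ` space M. (\<Sum>i\<in>I. c i * complex_of_real (measure (m i) {x\<in>space M. F n x = y})) * y)"
      by (subst sum.swap) (simp add: sum_distrib_right)
    also have "\<dots> = 0" using 0[OF meas] by simp
    finally show ?thesis .
  qed
  moreover have "(\<lambda>n. \<Sum>i\<in>I. c i * (\<integral>x. F n x \<partial>m i)) \<longlonglongrightarrow> (\<Sum>i\<in>I. c i * (\<integral>x. g x \<partial>m i))"
  proof (intro tendsto_sum tendsto_mult tendsto_const)
    fix i assume i: "i \<in> I"
    interpret finite_measure "m i" by (rule m(1)[OF i])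
    note bm = measurable_cong_sets[OF m(2)[OF i] refl]
    show "(\<lambda>n. \<integral>x. F n x \<partial>m i) \<longlonglongrightarrow> (\<integral>x. g x \<partial>m i)"
    proof (rule integral_dominated_convergence[where w = "\<lambda>_. 2 * C"])
      show "AE x in m i. cmod (F n x) \<le> 2 * C" for n
      proof (rule AE_I2)
        fix x assume "x \<in> space (m i)"
        then show "cmod (F n x) \<le> 2 * C" using F(3)[of x n] g(2)[of x] by (simp add: sp[OF i])
      qed
      show "AE x in m i. (\<lambda>n. F n x) \<longlonglongrightarrow> g x"
        using F(2) by (intro AE_I2) (simp add: sp[OF i])
      show "F n \<in> borel_measurable (m i)" for n
        unfolding bm using F(1) by (rule borel_measurable_simple_function)
      show "g \<in> borel_measurable (m i)" unfolding bm by (rule g(1))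
    qed simp
  qed
  ultimately show ?thesis by (simp add: LIMSEQ_const_iff)
qed

text \<open>The difference of two representations, indexed by the disjoint sum, represents the zero
  set function. This frees \<open>complex_integral\<close> from the Jordan parts in its
  definition.\<close>

lemma measure_combination_integral_unique:
  fixes g :: "'a \<Rightarrow> complex"
  assumes 1: "measure_combination M I c m \<mu>" and 2: "measure_combination M J d n \<mu>"
    and g: "g \<in> borel_measurable M" "\<And>x. x \<in> space M \<Longrightarrow> cmod (g x) \<le> C"
  shows "(\<Sum>i\<in>I. c i * (\<integral>x. g x \<partial>m i)) = (\<Sum>j\<in>J. d j * (\<integral>x. g x \<partial>n j))"
proof -
  have "(\<Sum>k\<in>I <+> J. case_sum c (\<lambda>j. - d j) k * (\<integral>x. g x \<partial>case_sum m n k)) = 0"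
  proof (rule sum_integral_eq_0[where M = M, OF _ _ _ _ g])
    show "(\<Sum>k\<in>I <+> J. case_sum c (\<lambda>j. - d j) k * complex_of_real (measure (case_sum m n k) E)) = 0"
      if "E \<in> sets M" for E
    proof -
      have "(\<Sum>i\<in>I. c i * complex_of_real (measure (m i) E)) = (\<Sum>j\<in>J. d j * complex_of_real (measure (n j) E))"
        using 1 2 that unfolding measure_combination_def by metis
      then show ?thesis
        using 1 2 by (simp add: measure_combination_def sum.Plus sum_negf)
    qed
  qed (use 1 2 in \<open>auto simp: measure_combination_def\<close>)
  then show ?thesis
    using 1 2 by (simp add: measure_combination_def sum.Plus sum_negf)
qed

lemma measure_combination_imp_complex_measure:
  assumes \<mu>: "measure_combination M I c m \<mu>" and "\<And>E. E \<notin> sets M \<Longrightarrow> \<mu> E = 0"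
  shows "complex_measure M \<mu>"
proof -
  have "(\<lambda>n. \<mu> (A n)) sums \<mu> (\<Union>n. A n)"
    if A: "range A \<subseteq> sets M" "disjoint_family A" for A :: "nat \<Rightarrow> _"
  proof -
    have "(\<lambda>n. \<Sum>i\<in>I. c i * measure (m i) (A n)) sums (\<Sum>i\<in>I. c i * measure (m i) (\<Union>n. A n))"
      using \<mu> A unfolding measure_combination_def
      by (intro sums_sum sums_mult sums_of_real finite_measure.finite_measure_UNION) auto
    moreover have "\<mu> (A n) = (\<Sum>i\<in>I. c i * measure (m i) (A n))" for n
      using \<mu> A(1) unfolding measure_combination_def by blast
    moreover have "\<mu> (\<Union>n. A n) = (\<Sum>i\<in>I. c i * measure (m i) (\<Union>n. A n))"
    proof -
      have "(\<Union>n. A n) \<in> sets M" using A(1) by blast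
      then show ?thesis using \<mu> unfolding measure_combination_def by blast
    qed
    ultimately show ?thesis by presburger
  qed
  then show ?thesis using assms(2) by (simp add: complex_measure_def)
qed

lemma complex_integral_eq_combination:
  assumes \<mu>: "complex_measure M \<mu>" and "measure_combination M I c m \<mu>"
    and "g \<in> borel_measurable M" "\<And>x. x \<in> space M \<Longrightarrow> cmod (g x) \<le> C"
  shows "complex_integral M \<mu> g = (\<Sum>i\<in>I. c i * (\<integral>x. g x \<partial>m i))"
  unfolding complex_integral_jordan
  by (rule measure_combination_integral_unique[OF measure_combination_jordan[OF \<mu>] assms(2-)])

lemma measure_combination_add:
  assumes "measure_combination M I c m \<mu>" "measure_combination M J d n \<nu>"
  shows "measure_combination M (I <+> J) (case_sum c d) (case_sum m n) (\<lambda>E. \<mu> E + \<nu> E)"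
  using assms by (auto simp: measure_combination_def sum.Plus)

lemma measure_combination_cmult:
  assumes "measure_combination M I c m \<mu>"
  shows "measure_combination M I (\<lambda>i. a * c i) m (\<lambda>E. a * \<mu> E)"
  using assms by (auto simp: measure_combination_def sum_distrib_left mult.assoc)

section \<open>Regularity of complex measures on the circle\<close>

lemma complex_measure_Un:
  assumes \<mu>: "complex_measure M \<mu>" "A \<in> sets M" "B \<in> sets M" "A \<inter> B = {}"
  shows "\<mu> (A \<union> B) = \<mu> A + \<mu> B"
  using signed_measure_Un[OF signed_measure_Re[OF \<mu>(1), of 1] \<mu>(2-)]
    signed_measure_Un[OF signed_measure_Re[OF \<mu>(1), of "-\<i>"] \<mu>(2-)]
  by (simp add: complex_eq_iff)

lemma total_variation_upper:
  "range A \<subseteq> sets M \<Longrightarrow> disjoint_family A \<Longrightarrow> (\<Union>n. A n) = E \<Longrightarrow>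
    (\<Sum>n. ennreal (cmod (\<mu> (A n)))) \<le> total_variation M \<mu> E"
  unfolding total_variation_def by (rule SUP_upper) simp

lemma total_variation_least:
  assumes "\<And>A :: nat \<Rightarrow> _. range A \<subseteq> sets M \<Longrightarrow> disjoint_family A \<Longrightarrow> (\<Union>n. A n) = E \<Longrightarrow>
    (\<Sum>n. ennreal (cmod (\<mu> (A n)))) \<le> x"
  shows "total_variation M \<mu> E \<le> x"
  unfolding total_variation_def using assms by (intro SUP_least) blast

lemma total_variation_mono:
  assumes "E \<in> sets M" "F \<in> sets M" "E \<subseteq> F"
  shows "total_variation M \<mu> E \<le> total_variation M \<mu> F"
proof (rule total_variation_least)
  fix A :: "nat \<Rightarrow> _"
  assume A: "range A \<subseteq> sets M" "disjoint_family A" "(\<Union>n. A n) = E"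
  \<comment> \<open>Prepending \<open>F - E\<close> extends a partition of \<open>E\<close> to one
    of \<open>F\<close>.\<close>
  define A' where "A' = case_nat (F - E) A"
  have "range A' = insert (F - E) (range A)"
    by (subst UNIV_nat_eq) (simp add: A'_def image_image)
  then have A': "range A' \<subseteq> sets M" "(\<Union>n. A' n) = F"
    using A(1,3) assms by auto
  have "A n \<subseteq> E" for n using A(3) by blast
  then have "A' i \<inter> A' j = {}" if "i \<noteq> j" for i j
    using A(2) that by (cases i; cases j) (auto simp: A'_def disjoint_family_on_def)
  then have "disjoint_family A'" by (simp add: disjoint_family_on_def)
  have "(\<Sum>i<n. ennreal (cmod (\<mu> (A i)))) \<le> total_variation M \<mu> F" for n
  proof -
    have "(\<Sum>i<n. ennreal (cmod (\<mu> (A i)))) \<le> (\<Sum>i<Suc n. ennreal (cmod (\<mu> (A' i))))"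
      unfolding sum.lessThan_Suc_shift by (simp add: A'_def add_increasing)
    also have "\<dots> \<le> (\<Sum>i. ennreal (cmod (\<mu> (A' i))))"
      by (rule sum_le_suminf) auto
    also have "\<dots> \<le> total_variation M \<mu> F"
      by (rule total_variation_upper) fact+
    finally show ?thesis .
  qed
  then show "(\<Sum>n. ennreal (cmod (\<mu> (A n)))) \<le> total_variation M \<mu> F"
    by (intro suminf_le_const) auto
qed

text \<open>Each piece of a partition of the union is cut along \<open>E\<close> and
  \<open>F\<close>.\<close>

lemma total_variation_Un_le:
  assumes \<mu>: "complex_measure M \<mu>" and EF: "E \<in> sets M" "F \<in> sets M" "E \<inter> F = {}"
  shows "total_variation M \<mu> (E \<union> F) \<le> total_variation M \<mu> E + total_variation M \<mu> F"
proof (rule total_variation_least)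
  fix A :: "nat \<Rightarrow> _"
  assume A: "range A \<subseteq> sets M" "disjoint_family A" "(\<Union>n. A n) = E \<union> F"
  have "(\<Sum>n. ennreal (cmod (\<mu> (A n))))
     \<le> (\<Sum>n. ennreal (cmod (\<mu> (A n \<inter> E))) + ennreal (cmod (\<mu> (A n \<inter> F))))"
  proof (rule suminf_le)
    fix n
    have "A n = (A n \<inter> E) \<union> (A n \<inter> F)" using A(3) by blast
    then have "\<mu> (A n) = \<mu> ((A n \<inter> E) \<union> (A n \<inter> F))" by (rule arg_cong)
    also have "\<dots> = \<mu> (A n \<inter> E) + \<mu> (A n \<inter> F)"
      using A(1) EF by (intro complex_measure_Un[OF \<mu>]) auto
    finally show "ennreal (cmod (\<mu> (A n))) \<le> ennreal (cmod (\<mu> (A n \<inter> E))) + ennreal (cmod (\<mu> (A n \<inter> F)))"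
      by (simp add: norm_triangle_ineq flip: ennreal_plus)
  qed auto
  also have "\<dots> = (\<Sum>n. ennreal (cmod (\<mu> (A n \<inter> E)))) + (\<Sum>n. ennreal (cmod (\<mu> (A n \<inter> F))))"
    by (rule suminf_add[symmetric]) auto
  also have "\<dots> \<le> total_variation M \<mu> E + total_variation M \<mu> F"
    using A EF by (intro add_mono total_variation_upper) (auto simp: disjoint_family_on_def)
  finally show "(\<Sum>n. ennreal (cmod (\<mu> (A n)))) \<le> total_variation M \<mu> E + total_variation M \<mu> F" .
qed

text \<open>The triangle inequality on each piece reduces smallness of the variation to smallness
  under finitely many positive measures, for which regularity is available.\<close>

lemma total_variation_le_combination:
  assumes \<mu>: "measure_combination M I c m \<mu>" and E: "E \<in> sets M"
  shows "total_variation M \<mu> E \<le> ennreal (\<Sum>i\<in>I. cmod (c i) * measure (m i) E)"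
proof (rule total_variation_least)
  fix A :: "nat \<Rightarrow> _"
  assume A: "range A \<subseteq> sets M" "disjoint_family A" "(\<Union>n. A n) = E"
  have "(\<Sum>n. ennreal (cmod (\<mu> (A n)))) \<le> (\<Sum>n. ennreal (\<Sum>i\<in>I. cmod (c i) * measure (m i) (A n)))"
  proof (intro suminf_le ennreal_leI)
    fix n
    have "\<mu> (A n) = (\<Sum>i\<in>I. c i * measure (m i) (A n))"
      using \<mu> A(1) unfolding measure_combination_def by blast
    also have "cmod \<dots> \<le> (\<Sum>i\<in>I. cmod (c i) * measure (m i) (A n))"
      by (rule norm_sum[THEN order_trans]) (simp add: norm_mult)
    finally show "cmod (\<mu> (A n)) \<le> (\<Sum>i\<in>I. cmod (c i) * measure (m i) (A n))" .
  qed auto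
  also have "\<dots> = ennreal (\<Sum>i\<in>I. cmod (c i) * measure (m i) (\<Union>n. A n))"
    using \<mu> A unfolding measure_combination_def
    by (intro suminf_ennreal_eq sum_nonneg sums_sum sums_mult finite_measure.finite_measure_UNION) auto
  finally show "(\<Sum>n. ennreal (cmod (\<mu> (A n)))) \<le> ennreal (\<Sum>i\<in>I. cmod (c i) * measure (m i) E)"
    using A(3) by simp
qed

lemma space_circle_borel [simp]: "space circle_borel = sphere 0 1"
  by (simp add: circle_borel_def space_restrict_space)

lemma sets_circle_borel_iff: "E \<in> sets circle_borel \<longleftrightarrow> E \<subseteq> sphere 0 1 \<and> E \<in> sets borel"
  unfolding circle_borel_def by (subst sets_restrict_space_iff) auto

lemma measurable_circle_borel_continuous:
  "continuous_on (sphere 0 1) f \<Longrightarrow> f \<in> borel_measurable circle_borel"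
  unfolding circle_borel_def by (rule borel_measurable_continuous_on_restrict)

text \<open>Finite Borel measures on a Polish space are regular; \<open>m\<close> is transported to
  the plane along the inclusion of the circle to apply this.\<close>

lemma finite_circle_measure_regular:
  assumes m: "finite_measure m" "sets m = sets circle_borel" and E: "E \<in> sets circle_borel" and "\<delta> > 0"
  shows "\<exists>U. open U \<and> E \<subseteq> U \<and> measure m (sphere 0 1 \<inter> U - E) < \<delta>"
    and "\<exists>K. compact K \<and> K \<subseteq> E \<and> measure m (E - K) < \<delta>"
proof -
  interpret finite_measure m by (rule m(1))
  have sp: "space m = sphere 0 1" using sets_eq_imp_space_eq[OF m(2)] by simp
  define n where "n = distr m borel (\<lambda>x. x)"
  have meas: "(\<lambda>x. x) \<in> m \<rightarrow>\<^sub>M borel"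
    unfolding measurable_cong_sets[OF m(2) refl]
    by (rule measurable_circle_borel_continuous) (rule continuous_on_id)
  interpret n: finite_measure n
    unfolding n_def by (rule finite_measure_distr[OF meas])
  have n: "measure n B = measure m (sphere 0 1 \<inter> B)" if "B \<in> sets borel" for B
    unfolding n_def using that meas by (subst measure_distr) (auto simp: sp Int_commute)
  have n_top: "emeasure n (space n) \<noteq> \<infinity>" by simp
  have E': "E \<subseteq> sphere 0 1" "E \<in> sets borel" using E by (simp_all add: sets_circle_borel_iff)
  have sn: "sets n = sets borel" by (simp add: n_def)
  have nE: "measure n E = measure m E" using n[OF E'(2)] E'(1) by (simp add: Int_absorb1)
  have "(INF U \<in> {U. E \<subseteq> U \<and> open U}. emeasure n U) < ennreal (measure m E + \<delta>)"
    unfolding outer_regular[OF sn n_top E'(2), symmetric] unfolding n.emeasure_eq_measure nE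
    using \<open>\<delta> > 0\<close> by (intro ennreal_lessI add_nonneg_pos) auto
  then obtain U where U: "E \<subseteq> U" "open U" "measure n U < measure m E + \<delta>"
    by (auto simp: INF_less_iff n.emeasure_eq_measure ennreal_less_iff)
  have "sphere 0 1 \<inter> U \<in> sets m"
    using U(2) by (auto simp: m(2) sets_circle_borel_iff)
  then have "measure m (sphere 0 1 \<inter> U - E) = measure m (sphere 0 1 \<inter> U) - measure m E"
    using E E' U m(2) by (intro finite_measure_Diff) auto
  then show "\<exists>U. open U \<and> E \<subseteq> U \<and> measure m (sphere 0 1 \<inter> U - E) < \<delta>"
    using U n[of U] by (intro exI[of _ U]) auto
  show "\<exists>K. compact K \<and> K \<subseteq> E \<and> measure m (E - K) < \<delta>"
  \<comment> \<open>If \<open>measure m E - \<delta>\<close> were negative, \<open>ennreal\<close>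
    would truncate it and the strict inequality could fail; the empty set serves in that
    case.\<close>
  proof (cases "measure m E < \<delta>")
    case True
    then show ?thesis by (intro exI[of _ "{}"]) auto
  next
    case False
    with \<open>\<delta> > 0\<close> have "ennreal (measure m E - \<delta>) < (SUP K \<in> {K. K \<subseteq> E \<and> compact K}. emeasure n K)"
      unfolding inner_regular[OF sn n_top E'(2), symmetric] unfolding n.emeasure_eq_measure nE
      using \<open>\<delta> > 0\<close> by (intro ennreal_lessI) auto
    then obtain K where K: "K \<subseteq> E" "compact K" "measure m E - \<delta> < measure n K"
      using False by (auto simp: less_SUP_iff n.emeasure_eq_measure ennreal_less_iff)
    have "K \<in> sets m"
      using K(1,2) E'(1) by (auto simp: m(2) sets_circle_borel_iff intro: borel_compact)
    then have "measure m (E - K) = measure m E - measure m K"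
      using E K m(2) by (intro finite_measure_Diff) auto
    moreover have "measure n K = measure m K"
      using n[of K] K E'(1) by (metis borel_compact inf.absorb2 order_trans)
    ultimately show ?thesis using K by (intro exI[of _ K]) auto
  qed
qed

text \<open>Approximating sets are chosen for each of the finitely many positive measures and then
  intersected (open) or united (compact). The excess is small for all of them, hence small in
  variation.\<close>

lemma regular_circle_measure_combination:
  assumes \<mu>: "complex_measure circle_borel \<mu>" and comb: "measure_combination circle_borel I c m \<mu>"
  shows "regular_circle_measure \<mu>"
proof -
  let ?M = circle_borel
  have m: "finite_measure (m i)" "sets (m i) = sets ?M" if "i \<in> I" for i
    using comb that by (auto simp: measure_combination_def)
  have "finite I" using comb by (simp add: measure_combination_def)
  have openin_sets: "U \<in> sets ?M" if "openin (top_of_set (sphere 0 1)) U" for U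
    using that by (auto simp: openin_open sets_circle_borel_iff)
  have compact_sets: "K \<in> sets ?M" if "compact K" "K \<subseteq> sphere 0 1" for K
    using that by (auto simp: sets_circle_borel_iff intro: borel_compact)
  \<comment> \<open>The summand 1 keeps \<open>s\<close> positive when all coefficients vanish, so
    that \<open>\<epsilon> / s\<close> can be allotted to each measure.\<close>
  define s where "s = (\<Sum>i\<in>I. cmod (c i)) + 1"
  have s: "s > 0" by (simp add: s_def add_nonneg_pos sum_nonneg)
  have small: "total_variation ?M \<mu> F \<le> ennreal \<epsilon>"
    if F: "F \<in> sets ?M" and *: "\<And>i. i \<in> I \<Longrightarrow> measure (m i) F \<le> \<epsilon> / s" and "\<epsilon> > 0" for F \<epsilon>
  proof -
    have "(\<Sum>i\<in>I. cmod (c i) * measure (m i) F) \<le> (\<Sum>i\<in>I. cmod (c i) * (\<epsilon> / s))"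
      using * by (intro sum_mono mult_left_mono) auto
    also have "\<dots> = (s - 1) * (\<epsilon> / s)"
      unfolding sum_distrib_right[symmetric] by (simp add: s_def)
    also have "\<dots> \<le> s * (\<epsilon> / s)"
      using s \<open>\<epsilon> > 0\<close> by (intro mult_right_mono) auto
    also have "\<dots> = \<epsilon>" using s by simp
    finally show ?thesis
      using total_variation_le_combination[OF comb F] by (meson ennreal_leI order_trans)
  qed
  have outer: "total_variation ?M \<mu> E =
      (INF U \<in> {U. openin (top_of_set (sphere 0 1)) U \<and> E \<subseteq> U}. total_variation ?M \<mu> U)"
    if E: "E \<in> sets ?M" for E
  proof (rule antisym)
    show "total_variation ?M \<mu> E \<le>
        (INF U \<in> {U. openin (top_of_set (sphere 0 1)) U \<and> E \<subseteq> U}. total_variation ?M \<mu> U)"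
      using E openin_sets by (intro INF_greatest total_variation_mono) auto
    show "(INF U \<in> {U. openin (top_of_set (sphere 0 1)) U \<and> E \<subseteq> U}. total_variation ?M \<mu> U)
        \<le> total_variation ?M \<mu> E"
    proof (rule ennreal_le_epsilon)
      fix \<epsilon> :: real assume "\<epsilon> > 0"
      then have "\<forall>i\<in>I. \<exists>U. open U \<and> E \<subseteq> U \<and> measure (m i) (sphere 0 1 \<inter> U - E) < \<epsilon> / s"
        using finite_circle_measure_regular(1)[OF m E] s by simp
      then obtain U where U: "\<And>i. i \<in> I \<Longrightarrow> open (U i)" "\<And>i. i \<in> I \<Longrightarrow> E \<subseteq> U i"
          "\<And>i. i \<in> I \<Longrightarrow> measure (m i) (sphere 0 1 \<inter> U i - E) < \<epsilon> / s"
        by metis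
      define V where "V = sphere 0 1 \<inter> (\<Inter>i\<in>I. U i)"
      have "open (\<Inter>i\<in>I. U i)" using U(1) \<open>finite I\<close> by (intro open_INT) auto
      then have V: "openin (top_of_set (sphere 0 1)) V" unfolding V_def by (rule openin_open_Int)
      have EV: "E \<subseteq> V" using U(2) E by (auto simp: V_def sets_circle_borel_iff)
      have VE: "V - E \<in> sets ?M" using openin_sets[OF V] E by (rule sets.Diff)
      have "measure (m i) (V - E) \<le> \<epsilon> / s" if i: "i \<in> I" for i
      proof -
        interpret finite_measure "m i" by (rule m(1)[OF i])
        have "sphere 0 1 \<inter> U i \<in> sets (m i)"
          using U(1)[OF i] by (simp add: m(2)[OF i] openin_sets openin_open_Int)
        then have "measure (m i) (V - E) \<le> measure (m i) (sphere 0 1 \<inter> U i - E)"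
          using E i m(2)[OF i] by (intro finite_measure_mono) (auto simp: V_def)
        then show ?thesis using U(3)[OF i] by simp
      qed
      then have "total_variation ?M \<mu> (V - E) \<le> ennreal \<epsilon>"
        using VE \<open>\<epsilon> > 0\<close> by (intro small) auto
      moreover have "total_variation ?M \<mu> (E \<union> (V - E)) \<le> total_variation ?M \<mu> E + total_variation ?M \<mu> (V - E)"
        using E VE by (intro total_variation_Un_le[OF \<mu>]) auto
      moreover have "E \<union> (V - E) = V" using EV by blast
      ultimately have "total_variation ?M \<mu> V \<le> total_variation ?M \<mu> E + ennreal \<epsilon>"
        by (metis add_left_mono order_trans)
      then show "(INF U \<in> {U. openin (top_of_set (sphere 0 1)) U \<and> E \<subseteq> U}. total_variation ?M \<mu> U)
          \<le> total_variation ?M \<mu> E + ennreal \<epsilon>"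
        using V EV by (intro INF_lower2[of V]) auto
    qed
  qed
  have inner: "total_variation ?M \<mu> E = (SUP K \<in> {K. compact K \<and> K \<subseteq> E}. total_variation ?M \<mu> K)"
    if E: "E \<in> sets ?M" for E
  proof (rule antisym)
    have E1: "E \<subseteq> sphere 0 1" using E by (simp add: sets_circle_borel_iff)
    show "(SUP K \<in> {K. compact K \<and> K \<subseteq> E}. total_variation ?M \<mu> K) \<le> total_variation ?M \<mu> E"
      using E E1 compact_sets by (intro SUP_least total_variation_mono) auto
    show "total_variation ?M \<mu> E \<le> (SUP K \<in> {K. compact K \<and> K \<subseteq> E}. total_variation ?M \<mu> K)"
    proof (rule ennreal_le_epsilon)
      fix \<epsilon> :: real assume "\<epsilon> > 0"
      then have "\<forall>i\<in>I. \<exists>K. compact K \<and> K \<subseteq> E \<and> measure (m i) (E - K) < \<epsilon> / s"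
        using finite_circle_measure_regular(2)[OF m E] s by simp
      then obtain K where K: "\<And>i. i \<in> I \<Longrightarrow> compact (K i)" "\<And>i. i \<in> I \<Longrightarrow> K i \<subseteq> E"
          "\<And>i. i \<in> I \<Longrightarrow> measure (m i) (E - K i) < \<epsilon> / s"
        by metis
      define L where "L = (\<Union>i\<in>I. K i)"
      have L: "compact L" unfolding L_def using K(1) \<open>finite I\<close> by (intro compact_UN) auto
      have LE: "L \<subseteq> E" using K(2) by (auto simp: L_def)
      have Ls: "L \<in> sets ?M" using L LE E1 by (intro compact_sets) auto
      have EL: "E - L \<in> sets ?M" using E Ls by (rule sets.Diff)
      have "measure (m i) (E - L) \<le> \<epsilon> / s" if i: "i \<in> I" for i
      proof -
        interpret finite_measure "m i" by (rule m(1)[OF i])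
        have "K i \<in> sets (m i)"
          using K(1,2)[OF i] E1 by (simp add: m(2)[OF i] compact_sets)
        then have "measure (m i) (E - L) \<le> measure (m i) (E - K i)"
          using E i m(2)[OF i] by (intro finite_measure_mono) (auto simp: L_def)
        then show ?thesis using K(3)[OF i] by simp
      qed
      then have "total_variation ?M \<mu> (E - L) \<le> ennreal \<epsilon>"
        using EL \<open>\<epsilon> > 0\<close> by (intro small) auto
      moreover have "total_variation ?M \<mu> (L \<union> (E - L)) \<le> total_variation ?M \<mu> L + total_variation ?M \<mu> (E - L)"
        using Ls EL by (intro total_variation_Un_le[OF \<mu>]) auto
      moreover have "L \<union> (E - L) = E" using LE by blast
      moreover have "total_variation ?M \<mu> L \<le> (SUP K \<in> {K. compact K \<and> K \<subseteq> E}. total_variation ?M \<mu> K)"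
        using L LE by (intro SUP_upper) auto
      ultimately show "total_variation ?M \<mu> E
          \<le> (SUP K \<in> {K. compact K \<and> K \<subseteq> E}. total_variation ?M \<mu> K) + ennreal \<epsilon>"
        by (metis add_mono order_trans)
    qed
  qed
  show ?thesis unfolding regular_circle_measure_def using outer inner by blast
qed

text \<open>Regularity is automatic on the circle, so membership reduces to countable
  additivity.\<close>

lemma carrier_circle_measure_algebra:
  "carrier circle_measure_algebra = {\<mu>. complex_measure circle_borel \<mu>}"
  using regular_circle_measure_combination[OF _ measure_combination_jordan]
  by (auto simp: circle_measure_algebra_def)

section \<open>Fourier-Stieltjes transforms\<close>

lemma borel_measurable_power_int_circle: "(\<lambda>z. z powi k) \<in> borel_measurable circle_borel"
  by (intro measurable_circle_borel_continuous continuous_on_power_int continuous_on_id) auto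

lemma cmod_power_int_circle: "z \<in> sphere 0 1 \<Longrightarrow> cmod (z powi k) \<le> 1"
  by (simp add: norm_power_int)

lemma integrable_power_int_circle:
  assumes "finite_measure m" "sets m = sets circle_borel"
  shows "integrable m (\<lambda>z. z powi k)"
proof -
  interpret finite_measure m by fact
  have "space m = sphere 0 1" using sets_eq_imp_space_eq[OF assms(2)] by simp
  then have "AE z in m. cmod (z powi k) \<le> 1"
    using cmod_power_int_circle by (intro AE_I2) auto
  moreover have "(\<lambda>z. z powi k) \<in> borel_measurable m"
    unfolding measurable_cong_sets[OF assms(2) refl] by (rule borel_measurable_power_int_circle)
  ultimately show ?thesis by (rule integrable_const_bound)
qed

lemma fourier_stieltjes_eq_combination:
  assumes "complex_measure circle_borel \<mu>" "measure_combination circle_borel I c m \<mu>"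
  shows "fourier_stieltjes \<mu> n = (\<Sum>i\<in>I. c i * (\<integral>z. z powi (- n) \<partial>m i))"
  unfolding fourier_stieltjes_def
  by (rule complex_integral_eq_combination[OF assms borel_measurable_power_int_circle, where C = 1])
    (simp add: cmod_power_int_circle)

lemma complex_measure_add:
  assumes "complex_measure M \<mu>" "complex_measure M \<nu>"
  shows "complex_measure M (\<lambda>E. \<mu> E + \<nu> E)"
  using assms by (simp add: complex_measure_def sums_add)

lemma complex_measure_cmult:
  assumes "complex_measure M \<mu>"
  shows "complex_measure M (\<lambda>E. c * \<mu> E)"
  using assms by (simp add: complex_measure_def sums_mult)

text \<open>The Jordan parts of the sum are unrelated to those of the summands; the juxtaposed
  representation is integrated instead.\<close>

lemma fourier_stieltjes_add:
  assumes "complex_measure circle_borel \<mu>" "complex_measure circle_borel \<nu>"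
  shows "fourier_stieltjes (\<lambda>E. \<mu> E + \<nu> E) n = fourier_stieltjes \<mu> n + fourier_stieltjes \<nu> n"
proof -
  note J = assms[THEN measure_combination_jordan]
  show ?thesis
    by (subst fourier_stieltjes_eq_combination[OF complex_measure_add[OF assms] measure_combination_add[OF J]],
        subst fourier_stieltjes_eq_combination[OF assms(1) J(1)],
        subst fourier_stieltjes_eq_combination[OF assms(2) J(2)])
      (simp add: sum.Plus)
qed

lemma fourier_stieltjes_cmult:
  assumes "complex_measure circle_borel \<mu>"
  shows "fourier_stieltjes (\<lambda>E. c * \<mu> E) n = c * fourier_stieltjes \<mu> n"
  by (subst fourier_stieltjes_eq_combination[OF complex_measure_cmult[OF assms]
        measure_combination_cmult[OF measure_combination_jordan[OF assms]]],
      subst fourier_stieltjes_eq_combination[OF assms measure_combination_jordan[OF assms]])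
    (simp add: sum_distrib_left mult.assoc)

text \<open>As the image of counting measure on one point, the unit mass turns integration into
  evaluation at \<open>z\<close>.\<close>

lemma measure_combination_dirac:
  assumes "z \<in> sphere 0 1"
  shows "measure_combination circle_borel {()} (\<lambda>_. 1)
    (\<lambda>_. distr (count_space {()}) circle_borel (\<lambda>_. z)) (circle_dirac z)"
proof -
  interpret finite_measure "count_space {()}" by (rule finite_measure_count_space) simp
  have z: "(\<lambda>_. z) \<in> count_space {()} \<rightarrow>\<^sub>M circle_borel" using assms by simp
  have "(\<lambda>_. z) -` E \<inter> {()} = (if z \<in> E then {()} else {})" for E by auto
  then have "measure (distr (count_space {()}) circle_borel (\<lambda>_. z)) E = (if z \<in> E then 1 else 0)"
    if "E \<in> sets circle_borel" for E
    using that z by (simp add: measure_distr measure_count_space)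
  then show ?thesis
    using finite_measure_distr[OF z] by (simp add: measure_combination_def circle_dirac_def)
qed

lemma complex_measure_dirac: "z \<in> sphere 0 1 \<Longrightarrow> complex_measure circle_borel (circle_dirac z)"
  by (rule measure_combination_imp_complex_measure[OF measure_combination_dirac])
    (simp_all add: circle_dirac_def)

lemma fourier_stieltjes_dirac:
  assumes "z \<in> sphere 0 1"
  shows "fourier_stieltjes (circle_dirac z) n = z powi (- n)"
proof -
  have "(\<lambda>_. z) \<in> count_space {()} \<rightarrow>\<^sub>M circle_borel" using assms by simp
  then show ?thesis
    using fourier_stieltjes_eq_combination[OF complex_measure_dirac measure_combination_dirac, OF assms assms, of n]
    by (simp add: integral_distr borel_measurable_power_int_circle lebesgue_integral_count_space_finite)
qed

section \<open>Convolution and multiplicativity of the transform\<close>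

text \<open>This is the convolution of two positive measures. As an image measure it is countably
  additive by construction and accessible to Fubini's theorem.\<close>

definition circle_product :: "complex measure \<Rightarrow> complex measure \<Rightarrow> complex measure" where
  "circle_product m n = distr (m \<Otimes>\<^sub>M n) circle_borel (\<lambda>(s, t). s * t)"

context
  fixes m n :: "complex measure"
  assumes m: "finite_measure m" "sets m = sets circle_borel"
    and n: "finite_measure n" "sets n = sets circle_borel"
begin

lemma space_circle_measures: "space m = sphere 0 1" "space n = sphere 0 1"
  using sets_eq_imp_space_eq[OF m(2)] sets_eq_imp_space_eq[OF n(2)] by simp_all

lemma pair_sigma_finite_circle: "pair_sigma_finite m n"
  using m(1) n(1) by (simp add: pair_sigma_finite_def finite_measure_def)

lemma measurable_circle_mult: "(\<lambda>(s, t). s * t) \<in> m \<Otimes>\<^sub>M n \<rightarrow>\<^sub>M circle_borel"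
proof -
  have id: "(\<lambda>z. z) \<in> circle_borel \<rightarrow>\<^sub>M borel"
    by (rule measurable_circle_borel_continuous) (rule continuous_on_id)
  then have "(\<lambda>z. z) \<in> m \<rightarrow>\<^sub>M borel" "(\<lambda>z. z) \<in> n \<rightarrow>\<^sub>M borel"
    unfolding measurable_cong_sets[OF m(2) refl] measurable_cong_sets[OF n(2) refl] by blast+
  then have "fst \<in> m \<Otimes>\<^sub>M n \<rightarrow>\<^sub>M borel" "snd \<in> m \<Otimes>\<^sub>M n \<rightarrow>\<^sub>M borel"
    using measurable_compose[OF measurable_fst] measurable_compose[OF measurable_snd] by blast+
  then have "(\<lambda>(s, t). s * t) \<in> m \<Otimes>\<^sub>M n \<rightarrow>\<^sub>M borel"
    unfolding case_prod_beta' by (rule borel_measurable_times)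
  then show ?thesis
    unfolding circle_borel_def
    by (intro measurable_restrict_space2)
      (auto simp: space_pair_measure space_circle_measures norm_mult)
qed

lemma finite_measure_circle_product: "finite_measure (circle_product m n)"
  unfolding circle_product_def
  by (intro finite_measure.finite_measure_distr finite_measure_pair_measure m n measurable_circle_mult)

text \<open>Tonelli's theorem for the preimage \<open>Q\<close> of \<open>E\<close> under
  multiplication: its slice at \<open>t\<close> is the translate of \<open>E\<close> that occurs in
  \<open>circle_convolution\<close>.\<close>

lemma
  assumes E: "E \<in> sets circle_borel"
  shows borel_measurable_measure_translate:
      "(\<lambda>t. measure m {s \<in> sphere 0 1. s * t \<in> E}) \<in> borel_measurable n"
    and measure_circle_product:
      "measure (circle_product m n) E = (\<integral>t. measure m {s \<in> sphere 0 1. s * t \<in> E} \<partial>n)"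
proof -
  interpret m: finite_measure m by (rule m(1))
  interpret pair_sigma_finite m n by (rule pair_sigma_finite_circle)
  define Q where "Q = (\<lambda>(s, t). s * t) -` E \<inter> space (m \<Otimes>\<^sub>M n)"
  have Q: "Q \<in> sets (m \<Otimes>\<^sub>M n)"
    unfolding Q_def using measurable_circle_mult E by (rule measurable_sets)
  have Qt: "(\<lambda>s. (s, t)) -` Q = {s \<in> sphere 0 1. s * t \<in> E}" if "t \<in> space n" for t
    using that by (auto simp: Q_def space_pair_measure space_circle_measures)
  have "(\<lambda>t. enn2real (emeasure m ((\<lambda>s. (s, t)) -` Q))) \<in> borel_measurable n"
    using measurable_emeasure_Pair2[OF Q] by measurable
  then show meas: "(\<lambda>t. measure m {s \<in> sphere 0 1. s * t \<in> E}) \<in> borel_measurable n"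
    by (rule measurable_cong[THEN iffD1, rotated]) (simp add: Qt measure_def)
  have "emeasure (circle_product m n) E = emeasure (m \<Otimes>\<^sub>M n) Q"
    unfolding circle_product_def Q_def by (rule emeasure_distr[OF measurable_circle_mult E])
  also have "\<dots> = (\<integral>\<^sup>+t. emeasure m ((\<lambda>s. (s, t)) -` Q) \<partial>n)"
    by (rule emeasure_pair_measure_alt2[OF Q])
  also have "\<dots> = (\<integral>\<^sup>+t. ennreal (measure m {s \<in> sphere 0 1. s * t \<in> E}) \<partial>n)"
    by (intro nn_integral_cong) (simp add: Qt m.emeasure_eq_measure)
  finally have "emeasure (circle_product m n) E = (\<integral>\<^sup>+t. ennreal (measure m {s \<in> sphere 0 1. s * t \<in> E}) \<partial>n)" .
  then show "measure (circle_product m n) E = (\<integral>t. measure m {s \<in> sphere 0 1. s * t \<in> E} \<partial>n)"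
    using meas by (simp add: measure_def[of "circle_product m n"] integral_eq_nn_integral)
qed

text \<open>The power \<open>z powi k\<close> is a homomorphism on the circle, so Fubini's theorem
  separates the variables.\<close>

lemma integral_power_int_circle_product:
  "(\<integral>z. z powi k \<partial>circle_product m n) = (\<integral>z. z powi k \<partial>m) * (\<integral>z. z powi k \<partial>n)"
proof -
  interpret pair_sigma_finite m n by (rule pair_sigma_finite_circle)
  have "integrable (circle_product m n) (\<lambda>z. z powi k)"
    by (rule integrable_power_int_circle[OF finite_measure_circle_product])
      (simp add: circle_product_def)
  then have "integrable (m \<Otimes>\<^sub>M n) (\<lambda>p. (case p of (s, t) \<Rightarrow> s * t) powi k)"
    unfolding circle_product_def using measurable_circle_mult borel_measurable_power_int_circle
    by (subst (asm) integrable_distr_eq)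
  then have int: "integrable (m \<Otimes>\<^sub>M n) (case_prod (\<lambda>s t. s powi k * t powi k))"
    by (simp add: case_prod_beta' power_int_mult_distrib)
  have "(\<integral>z. z powi k \<partial>circle_product m n) = integral\<^sup>L (m \<Otimes>\<^sub>M n) (case_prod (\<lambda>s t. s powi k * t powi k))"
    unfolding circle_product_def using measurable_circle_mult borel_measurable_power_int_circle
    by (subst integral_distr) (simp_all add: case_prod_beta' power_int_mult_distrib)
  also have "\<dots> = (\<integral>t. \<integral>s. s powi k * t powi k \<partial>m \<partial>n)"
    by (rule integral_snd[OF int, symmetric])
  finally show ?thesis by simp
qed

end

text \<open>Bilinear expansion of the defining integral. It gives both countable additivity of the
  convolution and its transform.\<close>

lemma measure_combination_convolution:
  assumes \<nu>: "complex_measure circle_borel \<nu>"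
    and 1: "measure_combination circle_borel I c m \<mu>" and 2: "measure_combination circle_borel J d n \<nu>"
  shows "measure_combination circle_borel (I \<times> J) (\<lambda>(i, j). c i * d j)
    (\<lambda>(i, j). circle_product (m i) (n j)) (circle_convolution \<mu> \<nu>)"
proof -
  have m: "finite_measure (m i)" "sets (m i) = sets circle_borel" if "i \<in> I" for i
    using 1 that by (auto simp: measure_combination_def)
  have n: "finite_measure (n j)" "sets (n j) = sets circle_borel" if "j \<in> J" for j
    using 2 that by (auto simp: measure_combination_def)
  have fin: "finite I" "finite J" using 1 2 by (simp_all add: measure_combination_def)
  have "circle_convolution \<mu> \<nu> E = (\<Sum>(i, j)\<in>I \<times> J. c i * d j * measure (circle_product (m i) (n j)) E)"
    if E: "E \<in> sets circle_borel" for E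
  proof -
    define S where "S t = {s \<in> sphere 0 1. s * t \<in> E}" for t :: complex
    define C where "C = (\<Sum>i\<in>I. cmod (c i) * measure (m i) (space (m i)))"
    have S: "S t \<in> sets circle_borel" if "t \<in> sphere 0 1" for t
    proof -
      have "(\<lambda>s. s * t) \<in> circle_borel \<rightarrow>\<^sub>M circle_borel"
        by (subst (2) circle_borel_def, rule measurable_restrict_space2)
          (use that in \<open>auto simp: norm_mult intro!: measurable_circle_borel_continuous continuous_intros\<close>)
      from measurable_sets[OF this E] show ?thesis
        by (simp add: S_def vimage_def Int_def conj_commute)
    qed
    have \<mu>S: "\<mu> (S t) = (\<Sum>i\<in>I. c i * measure (m i) (S t))" if "t \<in> sphere 0 1" for t
      using 1 S[OF that] by (auto simp: measure_combination_def)
    have meas: "(\<lambda>t. measure (m i) (S t)) \<in> borel_measurable n'"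
      if "i \<in> I" "finite_measure n'" "sets n' = sets circle_borel" for i n'
      using borel_measurable_measure_translate[OF m[OF that(1)] that(2,3) E] by (simp add: S_def)
    have bound: "measure (m i) (S t) \<le> measure (m i) (space (m i))" if "i \<in> I" for i t
      using finite_measure.bounded_measure[OF m(1)[OF that]] .
    have int: "integrable (n j) (\<lambda>t. c i * complex_of_real (measure (m i) (S t)))" if "i \<in> I" "j \<in> J" for i j
      using bound[OF that(1)] meas[OF that(1) n[OF that(2)]]
      by (intro integrable_mult_right integrable_of_real
          finite_measure.integrable_const_bound[OF n(1)[OF that(2)], of _ "measure (m i) (space (m i))"]) auto
    \<comment> \<open>\<open>meas\<close> is stated for finite measures, but measurability depends
      only on the sigma-algebra; the null measure transfers it to
      \<open>circle_borel\<close>.\<close>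
    have null: "finite_measure (null_measure circle_borel :: complex measure)"
      by (rule finite_measureI) simp
    have "(\<lambda>t. \<mu> (S t)) \<in> borel_measurable circle_borel"
    proof (rule measurable_cong[THEN iffD2])
      show "(\<lambda>t. \<Sum>i\<in>I. c i * complex_of_real (measure (m i) (S t))) \<in> borel_measurable circle_borel"
      proof (intro borel_measurable_sum borel_measurable_times borel_measurable_const)
        fix i assume "i \<in> I"
        from meas[OF this null] have "(\<lambda>t. measure (m i) (S t)) \<in> borel_measurable circle_borel"
          by (simp add: measurable_def)
        then show "(\<lambda>t. complex_of_real (measure (m i) (S t))) \<in> borel_measurable circle_borel"
          by measurable
      qed
    qed (simp add: \<mu>S)
    moreover have "cmod (\<mu> (S t)) \<le> C" if "t \<in> space circle_borel" for t
    proof -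
      have "cmod (\<mu> (S t)) \<le> (\<Sum>i\<in>I. cmod (c i * complex_of_real (measure (m i) (S t))))"
        using that by (simp only: \<mu>S space_circle_borel norm_sum)
      also have "\<dots> \<le> C"
        unfolding C_def norm_mult by (intro sum_mono mult_left_mono) (auto simp: bound)
      finally show ?thesis .
    qed
    ultimately have "complex_integral circle_borel \<nu> (\<lambda>t. \<mu> (S t)) = (\<Sum>j\<in>J. d j * (\<integral>t. \<mu> (S t) \<partial>n j))"
      by (rule complex_integral_eq_combination[OF \<nu> 2])
    also have "\<dots> = (\<Sum>j\<in>J. \<Sum>i\<in>I. c i * d j * measure (circle_product (m i) (n j)) E)"
    proof (rule sum.cong[OF refl])
      fix j assume j: "j \<in> J"
      have "space (n j) = sphere 0 1" using sets_eq_imp_space_eq[OF n(2)[OF j]] by simp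
      then have "(\<integral>t. \<mu> (S t) \<partial>n j) = (\<integral>t. (\<Sum>i\<in>I. c i * complex_of_real (measure (m i) (S t))) \<partial>n j)"
        by (intro Bochner_Integration.integral_cong refl) (simp add: \<mu>S)
      also have "\<dots> = (\<Sum>i\<in>I. \<integral>t. c i * complex_of_real (measure (m i) (S t)) \<partial>n j)"
        using int j by (intro Bochner_Integration.integral_sum) auto
      also have "\<dots> = (\<Sum>i\<in>I. c i * measure (circle_product (m i) (n j)) E)"
        using measure_circle_product[OF m n[OF j] E] by (intro sum.cong refl) (simp add: S_def)
      finally show "d j * (\<integral>t. \<mu> (S t) \<partial>n j) = (\<Sum>i\<in>I. c i * d j * measure (circle_product (m i) (n j)) E)"
        by (simp add: sum_distrib_left mult_ac)
    qed
    also have "\<dots> = (\<Sum>(i, j)\<in>I \<times> J. c i * d j * measure (circle_product (m i) (n j)) E)"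
      by (subst sum.swap) (simp add: sum.cartesian_product)
    finally show ?thesis using E by (simp add: circle_convolution_def S_def)
  qed
  then show ?thesis
    using fin finite_measure_circle_product[OF m n]
    by (auto simp: measure_combination_def circle_product_def case_prod_beta)
qed

lemma complex_measure_convolution:
  assumes "complex_measure circle_borel \<mu>" "complex_measure circle_borel \<nu>"
  shows "complex_measure circle_borel (circle_convolution \<mu> \<nu>)"
  by (rule measure_combination_imp_complex_measure[OF
        measure_combination_convolution[OF assms(2) assms[THEN measure_combination_jordan]]])
    (simp add: circle_convolution_def)

lemma fourier_stieltjes_convolution:
  assumes "complex_measure circle_borel \<mu>" "complex_measure circle_borel \<nu>"
  shows "fourier_stieltjes (circle_convolution \<mu> \<nu>) k = fourier_stieltjes \<mu> k * fourier_stieltjes \<nu> k"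
proof -
  note J = assms[THEN measure_combination_jordan]
  have m: "finite_measure (jordan_part circle_borel \<rho> i)" "sets (jordan_part circle_borel \<rho> i) = sets circle_borel"
    if "complex_measure circle_borel \<rho>" "i < 4" for \<rho> i
    using measure_combination_jordan[OF that(1)] that(2) by (auto simp: measure_combination_def)
  have "fourier_stieltjes (circle_convolution \<mu> \<nu>) k
    = (\<Sum>(i, j)\<in>{..<4} \<times> {..<4}. (\<i> ^ i * (\<integral>z. z powi (- k) \<partial>jordan_part circle_borel \<mu> i))
        * (\<i> ^ j * (\<integral>z. z powi (- k) \<partial>jordan_part circle_borel \<nu> j)))"
    using m assms
    by (subst fourier_stieltjes_eq_combination[OF complex_measure_convolution[OF assms]
          measure_combination_convolution[OF assms(2) J]])
      (auto intro!: sum.cong simp: integral_power_int_circle_product)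
  also have "\<dots> = fourier_stieltjes \<mu> k * fourier_stieltjes \<nu> k"
    by (simp add: fourier_stieltjes_eq_combination[OF assms(1) J(1)] fourier_stieltjes_eq_combination[OF assms(2) J(2)]
        sum_product sum.cartesian_product)
  finally show ?thesis .
qed

lemma bounded_integral_power_int_circle:
  assumes "finite_measure m" "sets m = sets circle_borel"
  shows "bounded (range (\<lambda>n. \<integral>z. z powi (- n) \<partial>m))"
proof -
  interpret finite_measure m by fact
  have sp: "space m = sphere 0 1" using sets_eq_imp_space_eq[OF assms(2)] by simp
  have "cmod (\<integral>z. z powi (- n) \<partial>m) \<le> measure m (space m)" for n
  proof -
    have "cmod (\<integral>z. z powi (- n) \<partial>m) \<le> (\<integral>z. cmod (z powi (- n)) \<partial>m)"
      by (rule integral_norm_bound)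
    also have "\<dots> \<le> (\<integral>z. 1 \<partial>m)"
      using cmod_power_int_circle integrable_power_int_circle[OF assms]
      by (intro integral_mono) (auto simp: sp)
    finally show ?thesis by simp
  qed
  then show ?thesis unfolding bounded_iff by blast
qed

lemma bounded_range_sum:
  fixes f :: "'i \<Rightarrow> 'b \<Rightarrow> 'a::real_normed_vector"
  assumes "\<And>i. i \<in> I \<Longrightarrow> bounded (range (f i))"
  shows "bounded (range (\<lambda>n. \<Sum>i\<in>I. f i n))"
  using assms
proof (induction I rule: infinite_finite_induct)
  case (insert i I)
  then have "bounded (range (f i))" "bounded (range (\<lambda>n. \<Sum>i\<in>I. f i n))" by simp_all
  from bounded_plus_comp[OF this] show ?case using insert.hyps by simp
qed simp_all

lemma bounded_fourier_stieltjes: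
  assumes "complex_measure circle_borel \<mu>"
  shows "bounded (range (fourier_stieltjes \<mu>))"
proof -
  note J = measure_combination_jordan[OF assms]
  have b: "bounded (range (\<lambda>n. \<i> ^ k * (\<integral>z. z powi (- n) \<partial>jordan_part circle_borel \<mu> k)))" if "k < 4" for k
  proof -
    have "bounded (range (\<lambda>n. \<integral>z. z powi (- n) \<partial>jordan_part circle_borel \<mu> k))"
      using J that by (intro bounded_integral_power_int_circle) (auto simp: measure_combination_def)
    then show ?thesis by (simp add: bounded_iff norm_mult norm_power)
  qed
  have "fourier_stieltjes \<mu> = (\<lambda>n. \<Sum>k<4. \<i> ^ k * (\<integral>z. z powi (- n) \<partial>jordan_part circle_borel \<mu> k))"
    by (rule ext) (rule fourier_stieltjes_eq_combination[OF assms J])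
  moreover have "bounded (range (\<lambda>n. \<Sum>k<4. \<i> ^ k * (\<integral>z. z powi (- n) \<partial>jordan_part circle_borel \<mu> k)))"
    using b by (intro bounded_range_sum) auto
  ultimately show ?thesis by simp
qed

section \<open>Iterated limits of positive definite sequences\<close>

text \<open>
  \<open>\<Lambda>\<close> is in the closure of the evaluations at arbitrarily large \<open>n\<close>, for pointwise convergence on
  the bounded sequences. Its values at unbounded sequences are arbitrary.
\<close>

definition generalized_limit :: "((nat \<Rightarrow> complex) \<Rightarrow> complex) \<Rightarrow> bool" where
  "generalized_limit \<Lambda> \<longleftrightarrow>
     (\<forall>X \<epsilon> N. finite X \<longrightarrow> (\<forall>x\<in>X. bounded (range x)) \<longrightarrow> \<epsilon> > 0 \<longrightarrow>
        (\<exists>n\<ge>N. \<forall>x\<in>X. cmod (x n - \<Lambda> x) < \<epsilon>))"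

lemma generalized_limitD:
  assumes "generalized_limit \<Lambda>" "finite X" "\<And>x. x \<in> X \<Longrightarrow> bounded (range x)" "\<epsilon> > 0"
  obtains n where "n \<ge> N" "\<And>x. x \<in> X \<Longrightarrow> cmod (x n - \<Lambda> x) < \<epsilon>"
  using assms unfolding generalized_limit_def by meson

text \<open>Tychonoff's theorem does the work of a free ultrafilter: the evaluations lie in a
  product of closed discs, and any cluster point of their sequence is such a limit.\<close>

lemma generalized_limit_exists: "\<exists>\<Lambda>. generalized_limit \<Lambda>"
proof -
  define r :: "(nat \<Rightarrow> complex) \<Rightarrow> real"
    where "r x = (if bounded (range x) then SOME r. \<forall>n. cmod (x n) \<le> r else 0)" for x
  \<comment> \<open>Evaluations are replaced by 0 at unbounded sequences, where the disc has radius
    0, so that every coordinate stays in a compact disc.\<close>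
  define ev :: "nat \<Rightarrow> (nat \<Rightarrow> complex) \<Rightarrow> complex"
    where "ev n x = (if bounded (range x) then x n else 0)" for n x
  define K where "K = (\<Pi>\<^sub>E x\<in>UNIV. cball (0::complex) (r x))"
  have r: "cmod (x n) \<le> r x" if "bounded (range x)" for x n
  proof -
    have "\<exists>r. \<forall>n. cmod (x n) \<le> r" using that by (auto simp: bounded_iff)
    then have "\<forall>n. cmod (x n) \<le> (SOME r. \<forall>n. cmod (x n) \<le> r)" by (rule someI_ex)
    then show ?thesis using that by (simp add: r_def)
  qed
  have "compactin (product_topology (\<lambda>_. euclidean) UNIV) K"
    unfolding K_def by (subst compactin_PiE) (auto simp: compactin_euclidean_iff)
  then have "compact K"
    by (simp add: euclidean_product_topology compactin_euclidean_iff)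
  moreover have evK: "ev n \<in> K" for n
    using r by (auto simp: K_def ev_def r_def)
  moreover have "filtermap ev sequentially \<noteq> bot"
    by (simp add: filtermap_bot_iff)
  ultimately obtain \<Lambda> where \<Lambda>: "inf (nhds \<Lambda>) (filtermap ev sequentially) \<noteq> bot"
    unfolding compact_filter by (metis eventually_filtermap always_eventually)
  have "generalized_limit \<Lambda>"
    unfolding generalized_limit_def
  proof (intro allI impI)
    fix X :: "(nat \<Rightarrow> complex) set" and \<epsilon> :: real and N :: nat
    assume X: "finite X" "\<forall>x\<in>X. bounded (range x)" and \<epsilon>: "\<epsilon> > 0"
    \<comment> \<open>A basic neighbourhood in the product topology, restricting only the finitely
      many coordinates in \<open>X\<close>.\<close>
    define U where "U = (\<Pi>\<^sub>E x\<in>UNIV. if x \<in> X then ball (\<Lambda> x) \<epsilon> else UNIV)"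
    have "{x. (if x \<in> X then ball (\<Lambda> x) \<epsilon> else UNIV) \<noteq> UNIV} \<subseteq> X" by auto
    then have "open U"
      unfolding U_def using X(1) by (intro open_PiE) (auto intro: finite_subset)
    moreover have "\<Lambda> \<in> U" using \<epsilon> by (auto simp: U_def)
    ultimately have 1: "eventually (\<lambda>F. F \<in> U) (nhds \<Lambda>)"
      by (rule eventually_nhds_in_open)
    show "\<exists>n\<ge>N. \<forall>x\<in>X. cmod (x n - \<Lambda> x) < \<epsilon>"
    proof (rule ccontr)
      assume not_near: "\<not> ?thesis"
      have "ev n \<notin> U" if "n \<ge> N" for n
      proof -
        from that not_near obtain x where x: "x \<in> X" "\<not> cmod (x n - \<Lambda> x) < \<epsilon>" by blast
        then have "ev n x \<notin> ball (\<Lambda> x) \<epsilon>"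
          using X(2) by (simp add: ev_def dist_norm norm_minus_commute)
        then show ?thesis using x(1) unfolding U_def PiE_iff by (auto intro!: bexI[of _ x])
      qed
      then have "eventually (\<lambda>F. F \<notin> U) (filtermap ev sequentially)"
        unfolding eventually_filtermap eventually_sequentially by blast
      with 1 have "eventually (\<lambda>F. False) (inf (nhds \<Lambda>) (filtermap ev sequentially))"
        unfolding eventually_inf by blast
      then show False using \<Lambda> by (simp add: trivial_limit_def)
    qed
  qed
  then show ?thesis by blast
qed

text \<open>Carries identities from evaluations to \<Lambda>; \<open>C\<close> collects the error
  terms.\<close>

lemma eq_if_cmod_diff_less:
  fixes a b :: complex
  assumes "\<And>\<epsilon>::real. \<epsilon> > 0 \<Longrightarrow> cmod (a - b) < C * \<epsilon>" "C > 0"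
  shows "a = b"
proof (rule ccontr)
  assume "a \<noteq> b"
  then show False using assms(1)[of "cmod (a - b) / C"] assms(2) by simp
qed

context
  fixes \<Lambda> assumes \<Lambda>: "generalized_limit \<Lambda>"
begin

lemma generalized_limit_eventually_const:
  assumes "\<And>n. n \<ge> N \<Longrightarrow> x n = c" "bounded (range x)"
  shows "\<Lambda> x = c"
proof (rule eq_if_cmod_diff_less[where C = 1])
  fix \<epsilon> :: real assume "\<epsilon> > 0"
  then obtain n where "n \<ge> N" "cmod (x n - \<Lambda> x) < \<epsilon>"
    using generalized_limitD[OF \<Lambda>, of "{x}" \<epsilon> N] assms(2) by auto
  then show "cmod (\<Lambda> x - c) < 1 * \<epsilon>" using assms(1) by (simp add: norm_minus_commute)
qed simp

lemma generalized_limit_norm_le: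
  assumes "\<And>n. cmod (x n) \<le> C"
  shows "cmod (\<Lambda> x) \<le> C"
proof (rule field_le_epsilon)
  fix \<epsilon> :: real assume "\<epsilon> > 0"
  moreover have "bounded (range x)" using assms by (auto simp: bounded_iff)
  ultimately obtain n where "cmod (x n - \<Lambda> x) < \<epsilon>"
    using generalized_limitD[OF \<Lambda>, of "{x}" \<epsilon> 0] by auto
  then show "cmod (\<Lambda> x) \<le> C + \<epsilon>"
    using assms[of n] norm_triangle_ineq4[of "x n" "x n - \<Lambda> x"] by simp
qed

text \<open>One index \<open>n\<close> approximates \<Lambda> at both summands and at their sum, and
  evaluation at \<open>n\<close> is exactly additive. Products and conjugates are treated in the
  same way.\<close>

lemma generalized_limit_add:
  assumes "bounded (range x)" "bounded (range y)"
  shows "\<Lambda> (\<lambda>n. x n + y n) = \<Lambda> x + \<Lambda> y"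
proof (rule eq_if_cmod_diff_less[where C = 3])
  fix \<epsilon> :: real assume \<epsilon>: "\<epsilon> > 0"
  have b: "bounded (range (\<lambda>n. x n + y n))"
    using assms by (intro bounded_plus_comp)
  obtain n where n: "cmod (x n - \<Lambda> x) < \<epsilon>" "cmod (y n - \<Lambda> y) < \<epsilon>"
      "cmod ((x n + y n) - \<Lambda> (\<lambda>n. x n + y n)) < \<epsilon>"
    by (rule generalized_limitD[OF \<Lambda>, of "{x, y, \<lambda>n. x n + y n}" \<epsilon> 0]) (use assms b \<epsilon> in auto)
  have "\<Lambda> (\<lambda>n. x n + y n) - (\<Lambda> x + \<Lambda> y)
      = (x n - \<Lambda> x) + (y n - \<Lambda> y) - ((x n + y n) - \<Lambda> (\<lambda>n. x n + y n))"
    by simp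
  also have "cmod \<dots> \<le> cmod (x n - \<Lambda> x) + cmod (y n - \<Lambda> y) + cmod ((x n + y n) - \<Lambda> (\<lambda>n. x n + y n))"
    by (meson add_mono norm_triangle_ineq norm_triangle_ineq4 order_refl order_trans)
  finally show "cmod (\<Lambda> (\<lambda>n. x n + y n) - (\<Lambda> x + \<Lambda> y)) < 3 * \<epsilon>" using n by linarith
qed simp

lemma generalized_limit_mult:
  assumes "bounded (range x)" "bounded (range y)"
  shows "\<Lambda> (\<lambda>n. x n * y n) = \<Lambda> x * \<Lambda> y"
proof -
  obtain B where B: "B > 0" "\<And>n. cmod (x n) \<le> B"
    using assms(1) by (auto simp: bounded_pos)
  obtain B' where B': "\<And>n. cmod (y n) \<le> B'"
    using assms(2) by (auto simp: bounded_iff)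
  have "cmod (x n * y n) \<le> B * B'" for n
    unfolding norm_mult using B B' by (intro mult_mono) auto
  then have xy: "bounded (range (\<lambda>n. x n * y n))"
    unfolding bounded_iff by blast
  \<comment> \<open>The three parts of the constant come from the errors at the product, at
    \<open>y\<close> (multiplied by the bound of \<open>x\<close>) and at \<open>x\<close>
    (multiplied by the limit of \<open>y\<close>).\<close>
  show ?thesis
  proof (rule eq_if_cmod_diff_less[where C = "1 + B + cmod (\<Lambda> y)"])
    fix \<epsilon> :: real assume \<epsilon>: "\<epsilon> > 0"
    obtain n where n: "cmod (x n - \<Lambda> x) < \<epsilon>" "cmod (y n - \<Lambda> y) < \<epsilon>"
        "cmod ((x n * y n) - \<Lambda> (\<lambda>n. x n * y n)) < \<epsilon>"
      by (rule generalized_limitD[OF \<Lambda>, of "{x, y, \<lambda>n. x n * y n}" \<epsilon> 0]) (use assms xy \<epsilon> in auto)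
    have "\<Lambda> (\<lambda>n. x n * y n) - \<Lambda> x * \<Lambda> y
        = x n * (y n - \<Lambda> y) + (x n - \<Lambda> x) * \<Lambda> y - ((x n * y n) - \<Lambda> (\<lambda>n. x n * y n))"
      by (simp add: algebra_simps)
    also have "cmod \<dots> \<le> cmod (x n * (y n - \<Lambda> y)) + cmod ((x n - \<Lambda> x) * \<Lambda> y)
        + cmod ((x n * y n) - \<Lambda> (\<lambda>n. x n * y n))"
      by (meson add_mono norm_triangle_ineq norm_triangle_ineq4 order_refl order_trans)
    also have "cmod (x n * (y n - \<Lambda> y)) \<le> B * \<epsilon>"
      unfolding norm_mult using B n(2) by (intro mult_mono) auto
    also have "cmod ((x n - \<Lambda> x) * \<Lambda> y) \<le> \<epsilon> * cmod (\<Lambda> y)"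
      unfolding norm_mult using n(1) by (intro mult_right_mono) auto
    finally show "cmod (\<Lambda> (\<lambda>n. x n * y n) - \<Lambda> x * \<Lambda> y) < (1 + B + cmod (\<Lambda> y)) * \<epsilon>"
      using n(3) by (simp add: algebra_simps)
  qed (use B in \<open>simp add: add_pos_nonneg\<close>)
qed

lemma generalized_limit_const: "\<Lambda> (\<lambda>_. c) = c"
  by (rule generalized_limit_eventually_const) auto

lemma generalized_limit_cnj:
  assumes "bounded (range x)"
  shows "\<Lambda> (\<lambda>n. cnj (x n)) = cnj (\<Lambda> x)"
proof (rule eq_if_cmod_diff_less[where C = 2])
  fix \<epsilon> :: real assume \<epsilon>: "\<epsilon> > 0"
  have b: "bounded (range (\<lambda>n. cnj (x n)))"
    using assms by (auto simp: bounded_iff)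
  obtain n where n: "cmod (x n - \<Lambda> x) < \<epsilon>" "cmod (cnj (x n) - \<Lambda> (\<lambda>n. cnj (x n))) < \<epsilon>"
    by (rule generalized_limitD[OF \<Lambda>, of "{x, \<lambda>n. cnj (x n)}" \<epsilon> 0]) (use assms b \<epsilon> in auto)
  have "\<Lambda> (\<lambda>n. cnj (x n)) - cnj (\<Lambda> x) = cnj (x n - \<Lambda> x) - (cnj (x n) - \<Lambda> (\<lambda>n. cnj (x n)))"
    by simp
  also have "cmod \<dots> \<le> cmod (x n - \<Lambda> x) + cmod (cnj (x n) - \<Lambda> (\<lambda>n. cnj (x n)))"
    by (metis complex_mod_cnj norm_triangle_ineq4)
  finally show "cmod (\<Lambda> (\<lambda>n. cnj (x n)) - cnj (\<Lambda> x)) < 2 * \<epsilon>" using n by linarith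
qed simp

text \<open>The indices are picked one at a time: each new \<open>n\<close> is close to the limit in
  every row chosen before, and its own row limit is close to \<open>L\<close>.\<close>

lemma exists_near_iterated_limit:
  fixes a :: "int \<Rightarrow> complex"
  assumes "bounded (range a)" "\<epsilon> > 0"
  shows "\<exists>s :: nat \<Rightarrow> nat. \<forall>i j. i < j \<longrightarrow> j < K \<longrightarrow>
    cmod (a (int (s j) - int (s i)) - \<Lambda> (\<lambda>m. \<Lambda> (\<lambda>n. a (int n - int m)))) < \<epsilon>"
proof -
  define x where "x m n = a (int n - int m)" for m n :: nat
  define y where "y m = \<Lambda> (x m)" for m
  define L where "L = \<Lambda> y"
  obtain C where C: "\<And>n. cmod (a n) \<le> C" using assms(1) by (auto simp: bounded_iff)
  have bx: "bounded (range (x m))" for m using C by (auto simp: bounded_iff x_def)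
  have "cmod (y m) \<le> C" for m
    unfolding y_def by (rule generalized_limit_norm_le) (simp add: x_def C)
  then have by': "bounded (range y)" by (auto simp: bounded_iff)
  \<comment> \<open>The clause on \<open>y\<close> is the strengthening needed by the induction. One
    half of \<open>\<epsilon>\<close> measures an entry against its row limit, the other half a row
    limit against \<open>L\<close>.\<close>
  have "\<exists>s :: nat \<Rightarrow> nat. (\<forall>i<K. cmod (y (s i) - L) < \<epsilon> / 2) \<and>
      (\<forall>i j. i < j \<longrightarrow> j < K \<longrightarrow> cmod (x (s i) (s j) - L) < \<epsilon>)"
  proof (induction K)
    case 0 then show ?case by simp
  next
    case (Suc K)
    then obtain s :: "nat \<Rightarrow> nat" where s: "\<And>i. i < K \<Longrightarrow> cmod (y (s i) - L) < \<epsilon> / 2"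
      "\<And>i j. i < j \<Longrightarrow> j < K \<Longrightarrow> cmod (x (s i) (s j) - L) < \<epsilon>" by blast
    obtain n where n: "\<And>z. z \<in> insert y ((\<lambda>i. x (s i)) ` {..<K}) \<Longrightarrow> cmod (z n - \<Lambda> z) < \<epsilon> / 2"
      by (rule generalized_limitD[OF \<Lambda>, of "insert y ((\<lambda>i. x (s i)) ` {..<K})" "\<epsilon> / 2" 0])
        (use bx by' assms(2) in auto)
    have "cmod (x (s i) n - L) < \<epsilon>" if "i < K" for i
    proof -
      have "cmod (x (s i) n - L) \<le> cmod (x (s i) n - y (s i)) + cmod (y (s i) - L)"
        by (metis diff_add_cancel diff_diff_eq2 norm_triangle_ineq add_diff_eq)
      moreover have "cmod (x (s i) n - y (s i)) < \<epsilon> / 2"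
        using n that by (simp add: y_def)
      ultimately show ?thesis using s(1)[OF that] by linarith
    qed
    moreover have "cmod (y n - L) < \<epsilon> / 2" using n by (simp add: L_def)
    ultimately show ?case using s by (intro exI[of _ "s(K := n)"]) (auto simp: less_Suc_eq)
  qed
  then show ?thesis unfolding L_def y_def x_def by blast
qed

end

lemma sum_lessThan_add:
  fixes f :: "nat \<Rightarrow> 'a::comm_monoid_add"
  shows "(\<Sum>i<m + n. f i) = (\<Sum>i<m. f i) + (\<Sum>i<n. f (m + i))"
  by (induction n) (simp_all add: add.assoc)

text \<open>The real part of the form is blind to skew-Hermitian sequences, so Hermitian symmetry is
  a clause of its own.\<close>

definition positive_definite :: "(int \<Rightarrow> complex) \<Rightarrow> bool" where
  "positive_definite a \<longleftrightarrow> (\<forall>n. a (- n) = cnj (a n)) \<and>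
     (\<forall>N (s :: nat \<Rightarrow> int) c. 0 \<le> Re (\<Sum>i<N. \<Sum>j<N. c i * cnj (c j) * a (s j - s i)))"

text \<open>The matrix \<open>A\<close> of values of \<open>a\<close> is compared with an ideal
  matrix \<open>M\<close>, on which the form is computed exactly. The last term is the total error
  divided by the square of \<open>K\<close>.\<close>

lemma positive_definite_near_iterated_limit:
  fixes t :: real
  assumes \<Lambda>: "generalized_limit \<Lambda>" and a: "positive_definite a" "bounded (range a)"
    and "K > 0"
  defines "L \<equiv> \<Lambda> (\<lambda>m. \<Lambda> (\<lambda>n. a (int n - int m)))"
  shows "0 \<le> t\<^sup>2 * Re L - 2 * t * Im L + (1 + t\<^sup>2) * (4 + 2 * cmod (a 0 - of_real (Re L))) / real K"
proof -
  define \<epsilon> where "\<epsilon> = 1 / real K"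
  have \<epsilon>: "\<epsilon> > 0" using \<open>K > 0\<close> by (simp add: \<epsilon>_def)
  define D where "D = cmod (a 0 - of_real (Re L))"
  define d where "d = - Complex 1 t"
  define c where "c i = (if i < K then 1 else d)" for i :: nat
  \<comment> \<open>Every entry has real part \<open>Re L\<close>, which makes the block computation
    uniform. On the diagonal \<open>A\<close> equals \<open>a 0\<close>, possibly far from
    \<open>Re L\<close>; the discrepancy \<open>D\<close> affects only \<open>2 * K\<close>
    entries.\<close>
  define M where "M i j = (if i < j then L else if j < i then cnj L else of_real (Re L))" for i j :: nat
  obtain s :: "nat \<Rightarrow> nat" where s: "\<And>i j. i < j \<Longrightarrow> j < 2 * K \<Longrightarrow> cmod (a (int (s j) - int (s i)) - L) < \<epsilon>"
    using exists_near_iterated_limit[OF \<Lambda> a(2) \<epsilon>, of "2 * K"] unfolding L_def by blast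
  define A where "A i j = a (int (s j) - int (s i))" for i j
  have a_minus: "a (- n) = cnj (a n)" for n using a(1) by (simp add: positive_definite_def)
  have AM: "cmod (A i j - M i j) \<le> \<epsilon> + (if i = j then D else 0)" if "i < 2 * K" "j < 2 * K" for i j
  proof (cases i j rule: linorder_cases)
    case less then show ?thesis using s[of i j] that by (simp add: A_def M_def)
  next
    case equal then show ?thesis using \<epsilon> by (simp add: A_def M_def D_def)
  next
    case greater
    have "A i j = cnj (A j i)" using a_minus[of "int (s i) - int (s j)"] by (simp add: A_def)
    then have "cmod (A i j - M i j) = cmod (A j i - L)"
      using greater by (simp add: M_def flip: complex_cnj_diff)
    then show ?thesis using s[of j i] that greater by (simp add: A_def)
  qed
  have c: "cmod (c i * cnj (c j)) \<le> 1 + t\<^sup>2" for i j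
  proof -
    have d2: "(cmod d)\<^sup>2 = 1 + t\<^sup>2" by (simp add: d_def cmod_power2)
    have d1: "cmod d \<le> 1 + t\<^sup>2"
      \<comment> \<open>Since \<open>(cmod d)\<^sup>2 = 1 + t\<^sup>2\<close> is at least 1, one
        bound covers the products with zero, one and two factors \<open>d\<close>.\<close>
      by (rule power2_le_imp_le) (simp_all add: d2 power2_sum)
    show ?thesis using d1 d2 by (auto simp: c_def norm_mult simp flip: power2_eq_square)
  qed
  have "0 \<le> Re (\<Sum>i<2*K. \<Sum>j<2*K. c i * cnj (c j) * A i j)"
    using a(1) unfolding positive_definite_def A_def
    by (elim conjE) (erule allE[of _ "2*K"], erule allE[of _ "\<lambda>i. int (s i)"], blast)
  also have "(\<Sum>i<2*K. \<Sum>j<2*K. c i * cnj (c j) * A i j)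
     = (\<Sum>i<2*K. \<Sum>j<2*K. c i * cnj (c j) * M i j) + (\<Sum>i<2*K. \<Sum>j<2*K. c i * cnj (c j) * (A i j - M i j))"
    by (simp add: algebra_simps flip: sum.distrib)
  also have "Re \<dots> \<le> Re (\<Sum>i<2*K. \<Sum>j<2*K. c i * cnj (c j) * M i j)
      + cmod (\<Sum>i<2*K. \<Sum>j<2*K. c i * cnj (c j) * (A i j - M i j))"
    using complex_Re_le_cmod by (simp del: Re_sum)
  also have "cmod (\<Sum>i<2*K. \<Sum>j<2*K. c i * cnj (c j) * (A i j - M i j))
      \<le> (\<Sum>i<2*K. \<Sum>j<2*K. (1 + t\<^sup>2) * (\<epsilon> + (if i = j then D else 0)))"
    unfolding norm_mult[of "c i * cnj (c j)" for i j]
    by (intro order_trans[OF norm_sum] sum_mono order_trans[OF norm_sum])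
      (simp only: norm_mult[of "c i * cnj (c j)" for i j], intro mult_mono c AM, auto)
  also have "\<dots> = (1 + t\<^sup>2) * (\<Sum>i<2*K. \<Sum>j<2*K. \<epsilon> + (if i = j then D else 0))"
    by (simp add: sum_distrib_left)
  also have "\<dots> = (1 + t\<^sup>2) * (4 * (real K)\<^sup>2 * \<epsilon> + 2 * real K * D)"
    by (simp add: sum.distrib power2_eq_square algebra_simps)
  also have "Re (\<Sum>i<2*K. \<Sum>j<2*K. c i * cnj (c j) * M i j) = (real K)\<^sup>2 * (t\<^sup>2 * Re L - 2 * t * Im L)"
  proof -
    have MK: "M (i + K) (j + K) = M i j" for i j by (simp add: M_def)
    have cross: "M i (j + K) = L" "M (j + K) i = cnj L" if "i < K" for i j
      using that by (simp_all add: M_def)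
    \<comment> \<open>The four blocks of size \<open>K\<close> are folded onto one: the off-diagonal
      blocks are constant, and the two diagonal blocks agree up to the factor
      \<open>d * cnj d\<close>.\<close>
    have "(\<Sum>i<2*K. \<Sum>j<2*K. c i * cnj (c j) * M i j)
       = (\<Sum>i<K. \<Sum>j<K. M i j + cnj d * L + d * cnj L + (d * cnj d) * M i j)"
      by (simp add: mult_2 sum_lessThan_add c_def sum.distrib MK cross add_ac)
    also have "Re \<dots> = (\<Sum>i<K. \<Sum>j<K. t\<^sup>2 * Re L - 2 * t * Im L)"
      unfolding Re_sum
      by (intro sum.cong refl) (auto simp: M_def d_def power2_eq_square algebra_simps)
    finally show ?thesis by (simp add: power2_eq_square)
  qed
  finally have "0 \<le> (real K)\<^sup>2 * (t\<^sup>2 * Re L - 2 * t * Im L) + (1 + t\<^sup>2) * (4 * (real K)\<^sup>2 * \<epsilon> + 2 * real K * D)"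
    by simp
  also have "\<dots> = (real K)\<^sup>2 * (t\<^sup>2 * Re L - 2 * t * Im L + (1 + t\<^sup>2) * (4 + 2 * D) / real K)"
    using \<open>K > 0\<close> by (simp add: \<epsilon>_def power2_eq_square field_simps)
  finally show ?thesis using \<open>K > 0\<close> unfolding D_def by (simp add: zero_le_mult_iff)
qed

text \<open>Letting \<open>K\<close> grow removes the error term; a quadratic in \<open>t\<close>
  without constant term can stay nonnegative only if its linear coefficient vanishes.\<close>

lemma positive_definite_iterated_limit_real:
  assumes \<Lambda>: "generalized_limit \<Lambda>" and a: "positive_definite a" "bounded (range a)"
  shows "Im (\<Lambda> (\<lambda>m. \<Lambda> (\<lambda>n. a (int n - int m)))) = 0" (is "Im ?L = 0")
proof -
  have *: "0 \<le> t\<^sup>2 * Re ?L - 2 * t * Im ?L" for t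
  proof (rule LIMSEQ_le_const)
    show "(\<lambda>K. t\<^sup>2 * Re ?L - 2 * t * Im ?L + (1 + t\<^sup>2) * (4 + 2 * cmod (a 0 - of_real (Re ?L))) / real K)
      \<longlonglongrightarrow> t\<^sup>2 * Re ?L - 2 * t * Im ?L"
      by (rule tendsto_eq_intros lim_const_over_n refl)+ simp
    show "\<exists>N. \<forall>K\<ge>N. 0 \<le> t\<^sup>2 * Re ?L - 2 * t * Im ?L + (1 + t\<^sup>2) * (4 + 2 * cmod (a 0 - of_real (Re ?L))) / real K"
      using positive_definite_near_iterated_limit[OF assms] by (intro exI[of _ 1]) simp
  qed
  \<comment> \<open>At \<open>t = \<delta> * Im L\<close> this choice keeps the factor
    \<open>\<delta> * Re L - 2\<close> at most -1, so nonnegativity forces \<open>Im L\<close> to be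
    0.\<close>
  define \<delta> where "\<delta> = 1 / (1 + \<bar>Re ?L\<bar>)"
  have \<delta>: "\<delta> > 0" "\<delta> * Re ?L \<le> 1" by (simp_all add: \<delta>_def add_pos_nonneg field_simps)
  have "0 \<le> \<delta> * (Im ?L)\<^sup>2 * (\<delta> * Re ?L - 2)"
    using *[of "\<delta> * Im ?L"] by (simp add: power2_eq_square algebra_simps)
  then have "(Im ?L)\<^sup>2 \<le> 0"
    using \<delta> by (auto simp: zero_le_mult_iff mult_le_0_iff)
  then show ?thesis by simp
qed

lemma positive_definite_iterated_limits_eq:
  assumes \<Lambda>: "generalized_limit \<Lambda>" and a: "positive_definite a" "bounded (range a)"
  shows "\<Lambda> (\<lambda>m. \<Lambda> (\<lambda>n. a (int n - int m))) = \<Lambda> (\<lambda>m. \<Lambda> (\<lambda>n. a (int m - int n)))"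
proof -
  obtain C where C: "\<And>n. cmod (a n) \<le> C" using a(2) by (auto simp: bounded_iff)
  have b: "bounded (range (\<lambda>n. a (int n - int m)))" for m using C by (auto simp: bounded_iff)
  have "bounded (range (\<lambda>m. \<Lambda> (\<lambda>n. a (int n - int m))))"
    unfolding bounded_iff by (intro exI[of _ C] ballI, elim rangeE) (simp add: generalized_limit_norm_le[OF \<Lambda>] C)
  then have "\<Lambda> (\<lambda>m. cnj (\<Lambda> (\<lambda>n. a (int n - int m)))) = cnj (\<Lambda> (\<lambda>m. \<Lambda> (\<lambda>n. a (int n - int m))))"
    by (rule generalized_limit_cnj[OF \<Lambda>])
  moreover have "cnj (\<Lambda> (\<lambda>n. a (int n - int m))) = \<Lambda> (\<lambda>n. a (int m - int n))" for m
  proof -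
    have "cnj (a k) = a (- k)" for k using a(1) by (simp add: positive_definite_def)
    then show ?thesis using generalized_limit_cnj[OF \<Lambda> b, of m] by simp
  qed
  ultimately show ?thesis
    using positive_definite_iterated_limit_real[OF assms] by (simp add: complex_eq_iff)
qed

text \<open>The easy half of Herglotz's theorem: the form is the integral of the squared modulus of
  a trigonometric polynomial.\<close>

lemma positive_definite_circle_measure:
  assumes m: "finite_measure m" "sets m = sets circle_borel"
  shows "positive_definite (\<lambda>n. \<integral>z. z powi (- n) \<partial>m)"
  unfolding positive_definite_def
proof (intro conjI allI)
  have sp: "space m = sphere 0 1" using sets_eq_imp_space_eq[OF m(2)] by simp
  have cnj_powi: "cnj (z powi k) = z powi (- k)" if "z \<in> sphere 0 1" for z k
  proof -
    have "z * cnj z = 1" using complex_norm_square[of z] that by simp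
    then have "inverse z = cnj z" by (rule inverse_unique)
    then have "cnj z = inverse z" ..
    then show ?thesis by (simp add: power_int_minus power_int_inverse)
  qed
  show "(\<integral>z. z powi (- (- n)) \<partial>m) = cnj (\<integral>z. z powi (- n) \<partial>m)" for n
    unfolding Bochner_Integration.integral_cnj[symmetric]
    by (intro Bochner_Integration.integral_cong refl) (simp add: sp cnj_powi del: complex_cnj_power_int)
  fix N and s :: "nat \<Rightarrow> int" and c
  have "(\<Sum>i<N. \<Sum>j<N. c i * cnj (c j) * (\<integral>z. z powi (- (s j - s i)) \<partial>m))
     = (\<integral>z. (\<Sum>i<N. \<Sum>j<N. c i * cnj (c j) * z powi (- (s j - s i))) \<partial>m)"
    using integrable_power_int_circle[OF m] by (simp add: Bochner_Integration.integral_sum)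
  also have "\<dots> = (\<integral>z. of_real ((cmod (\<Sum>i<N. c i * z powi s i))\<^sup>2) \<partial>m)"
  proof (intro Bochner_Integration.integral_cong refl)
    fix z assume z: "z \<in> space m"
    then have "z \<noteq> 0" by (auto simp: sp)
    have "(\<Sum>i<N. \<Sum>j<N. c i * cnj (c j) * z powi (- (s j - s i)))
      = (\<Sum>i<N. \<Sum>j<N. (c i * z powi s i) * cnj (c j * z powi s j))"
      using z \<open>z \<noteq> 0\<close> unfolding sp
      by (intro sum.cong refl) (simp add: cnj_powi power_int_diff power_int_minus field_simps del: complex_cnj_power_int)
    also have "\<dots> = (\<Sum>i<N. c i * z powi s i) * cnj (\<Sum>i<N. c i * z powi s i)"
      by (simp only: cnj_sum sum_product)
    also have "\<dots> = of_real ((cmod (\<Sum>i<N. c i * z powi s i))\<^sup>2)"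
      by (rule complex_norm_square[symmetric])
    finally show "(\<Sum>i<N. \<Sum>j<N. c i * cnj (c j) * z powi (- (s j - s i)))
      = of_real ((cmod (\<Sum>i<N. c i * z powi s i))\<^sup>2)" .
  qed
  also have "\<dots> = of_real (\<integral>z. (cmod (\<Sum>i<N. c i * z powi s i))\<^sup>2 \<partial>m)"
    by (rule integral_complex_of_real)
  finally show "0 \<le> Re (\<Sum>i<N. \<Sum>j<N. c i * cnj (c j) * (\<integral>z. z powi (- (s j - s i)) \<partial>m))"
    by simp
qed

section \<open>Two characters given by iterated limits\<close>

text \<open>The index map \<open>h\<close> covers both \<open>n - m\<close> and
  \<open>m - n\<close>, so the character laws are proved once. The restriction matches the
  extensionality required by \<open>characters\<close>.\<close>

definition iterated_limit ::
    "((nat \<Rightarrow> complex) \<Rightarrow> complex) \<Rightarrow> (nat \<Rightarrow> nat \<Rightarrow> int) \<Rightarrow> (int \<Rightarrow> complex) \<Rightarrow> complex" where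
  "iterated_limit \<Lambda> h = (\<lambda>x\<in>carrier linf_int. \<Lambda> (\<lambda>m. \<Lambda> (\<lambda>n. x (h m n))))"

context
  fixes \<Lambda> assumes \<Lambda>: "generalized_limit \<Lambda>"
begin

lemma
  fixes x :: "int \<Rightarrow> complex"
  assumes "bounded (range x)"
  shows bounded_inner_limit: "bounded (range (\<lambda>n. x (h m n)))"
    and bounded_outer_limit: "bounded (range (\<lambda>m. \<Lambda> (\<lambda>n. x (h m n))))"
proof -
  obtain C where C: "\<And>n. cmod (x n) \<le> C" using assms by (auto simp: bounded_iff)
  then show "bounded (range (\<lambda>n. x (h m n)))" by (auto simp: bounded_iff)
  have "cmod (\<Lambda> (\<lambda>n. x (h m n))) \<le> C" for m
    by (rule generalized_limit_norm_le[OF \<Lambda>]) (rule C)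
  then show "bounded (range (\<lambda>m. \<Lambda> (\<lambda>n. x (h m n))))" unfolding bounded_iff by blast
qed

lemma iterated_limit_apply:
  "bounded (range x) \<Longrightarrow> iterated_limit \<Lambda> h x = \<Lambda> (\<lambda>m. \<Lambda> (\<lambda>n. x (h m n)))"
  by (simp add: iterated_limit_def linf_int_def)

lemma iterated_limit_add:
  assumes "bounded (range x)" "bounded (range y)"
  shows "iterated_limit \<Lambda> h (\<lambda>n. x n + y n) = iterated_limit \<Lambda> h x + iterated_limit \<Lambda> h y"
  using assms bounded_inner_limit[OF assms(1), where h = h] bounded_inner_limit[OF assms(2), where h = h]
    bounded_outer_limit[OF assms(1), where h = h] bounded_outer_limit[OF assms(2), where h = h]
  by (simp add: iterated_limit_apply bounded_plus_comp generalized_limit_add[OF \<Lambda>])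

lemma iterated_limit_mult:
  assumes "bounded (range x)" "bounded (range y)"
  shows "iterated_limit \<Lambda> h (\<lambda>n. x n * y n) = iterated_limit \<Lambda> h x * iterated_limit \<Lambda> h y"
proof -
  obtain A B where "\<And>n. cmod (x n) \<le> A" "\<And>n. cmod (y n) \<le> B"
    using assms by (auto simp: bounded_iff)
  then have "cmod (x n * y n) \<le> A * B" for n
    unfolding norm_mult by (intro mult_mono) (auto intro: order_trans[OF norm_ge_zero])
  then have "bounded (range (\<lambda>n. x n * y n))" unfolding bounded_iff by blast
  then show ?thesis
    using assms bounded_inner_limit[OF assms(1), where h = h] bounded_inner_limit[OF assms(2), where h = h]
      bounded_outer_limit[OF assms(1), where h = h] bounded_outer_limit[OF assms(2), where h = h]
    by (simp add: iterated_limit_apply generalized_limit_mult[OF \<Lambda>])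
qed

lemma iterated_limit_const: "iterated_limit \<Lambda> h (\<lambda>_. c) = c"
  by (subst iterated_limit_apply) (auto simp: generalized_limit_const[OF \<Lambda>])

lemma iterated_limit_cmult:
  "bounded (range x) \<Longrightarrow> iterated_limit \<Lambda> h (\<lambda>n. c * x n) = c * iterated_limit \<Lambda> h x"
  using iterated_limit_mult[of "\<lambda>_. c" x h] by (simp add: iterated_limit_const)

lemma iterated_limit_in_characters: "iterated_limit \<Lambda> h \<in> characters linf_int"
proof -
  have "iterated_limit \<Lambda> h \<in> extensional (carrier linf_int)"
    by (simp add: iterated_limit_def)
  moreover have "\<exists>x\<in>carrier linf_int. iterated_limit \<Lambda> h x \<noteq> 0"
    using iterated_limit_const[of h 1] by (intro bexI[of _ "\<lambda>_. 1"]) (auto simp: linf_int_def)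
  ultimately show ?thesis
    unfolding characters_def
    by (simp add: iterated_limit_add iterated_limit_mult iterated_limit_const linf_int_def)
qed

lemma iterated_limit_fourier_stieltjes:
  assumes \<mu>: "complex_measure circle_borel \<mu>"
  shows "iterated_limit \<Lambda> (\<lambda>m n. int n - int m) (fourier_stieltjes \<mu>)
    = iterated_limit \<Lambda> (\<lambda>m n. int m - int n) (fourier_stieltjes \<mu>)"
proof -
  define a where "a k n = (\<integral>z. z powi (- n) \<partial>jordan_part circle_borel \<mu> k)" for k n
  note J = measure_combination_jordan[OF \<mu>]
  have pd: "positive_definite (a k)" and bd: "bounded (range (a k))" if "k < 4" for k
    using J that unfolding a_def
    by (auto simp: measure_combination_def intro: positive_definite_circle_measure bounded_integral_power_int_circle)
  have bd': "bounded (range (\<lambda>n. \<i> ^ k * a k n))" if "k < 4" for k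
    using bd[OF that] by (simp add: bounded_iff norm_mult norm_power)
  \<comment> \<open>Additivity is known only for bounded sequences, so each partial sum has to be
    bounded on the way; the restriction \<open>K \<le> 4\<close> keeps every index in the range of
    the Jordan parts.\<close>
  have sum: "iterated_limit \<Lambda> h (\<lambda>n. \<Sum>k<K. \<i> ^ k * a k n) = (\<Sum>k<K. \<i> ^ k * iterated_limit \<Lambda> h (a k))"
    if "K \<le> 4" for h K
    using that
  proof (induction K)
    case 0
    then show ?case using iterated_limit_const[of h 0] by simp
  next
    case (Suc K)
    have "bounded (range (\<lambda>n. \<Sum>k<K. \<i> ^ k * a k n))"
      using Suc.prems by (intro bounded_range_sum bd') auto
    with Suc bd'[of K] bd[of K] show ?case
      by (simp add: iterated_limit_add iterated_limit_cmult)
  qed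
  have "fourier_stieltjes \<mu> = (\<lambda>n. \<Sum>k<4. \<i> ^ k * a k n)"
    unfolding a_def by (rule ext) (rule fourier_stieltjes_eq_combination[OF \<mu> J])
  moreover have "iterated_limit \<Lambda> (\<lambda>m n. int n - int m) (a k) = iterated_limit \<Lambda> (\<lambda>m n. int m - int n) (a k)"
    if "k < 4" for k
    using positive_definite_iterated_limits_eq[OF \<Lambda> pd bd] that by (simp add: iterated_limit_apply bd)
  ultimately show ?thesis by (simp add: sum)
qed

lemma iterated_limits_neq:
  "iterated_limit \<Lambda> (\<lambda>m n. int n - int m) \<noteq> iterated_limit \<Lambda> (\<lambda>m n. int m - int n)"
proof
  define x :: "int \<Rightarrow> complex" where "x k = (if k > 0 then 1 else 0)" for k
  have x: "bounded (range x)" unfolding bounded_iff by (auto simp: x_def intro!: exI[of _ 1])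
  \<comment> \<open>The indicator excludes 0, the value of the difference at \<open>n = m\<close>:
    here the constant tail starts at \<open>Suc m\<close>, for the other order already at
    \<open>m\<close>.\<close>
  have "\<Lambda> (\<lambda>n. x (int n - int m)) = 1" for m
    by (rule generalized_limit_eventually_const[OF \<Lambda> _
          bounded_inner_limit[OF x, where h = "\<lambda>m n. int n - int m"], where N = "Suc m"])
      (simp add: x_def)
  then have "iterated_limit \<Lambda> (\<lambda>m n. int n - int m) x = 1"
    by (simp add: iterated_limit_apply x generalized_limit_const[OF \<Lambda>])
  moreover have "\<Lambda> (\<lambda>n. x (int m - int n)) = 0" for m
    by (rule generalized_limit_eventually_const[OF \<Lambda> _
          bounded_inner_limit[OF x, where h = "\<lambda>m n. int m - int n"], where N = m])
      (simp add: x_def)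
  then have "iterated_limit \<Lambda> (\<lambda>m n. int m - int n) x = 0"
    by (simp add: iterated_limit_apply x generalized_limit_const[OF \<Lambda>])
  moreover assume "iterated_limit \<Lambda> (\<lambda>m n. int n - int m) = iterated_limit \<Lambda> (\<lambda>m n. int m - int n)"
  ultimately show False by simp
qed

end

section \<open>The homomorphism and its dual map\<close>

lemma characters_one:
  assumes "\<phi> \<in> characters linf_int"
  shows "\<phi> (\<lambda>_. 1) = 1"
proof -
  obtain x where x: "x \<in> carrier linf_int" "\<phi> x \<noteq> 0" using assms by (auto simp: characters_def)
  have one: "(\<lambda>_. 1) \<in> carrier linf_int" by (simp add: linf_int_def)
  have "\<forall>x\<in>carrier linf_int. \<forall>y\<in>carrier linf_int. \<phi> (x \<otimes>\<^bsub>linf_int\<^esub> y) = \<phi> x * \<phi> y"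
    using assms by (simp add: characters_def)
  then have "\<phi> ((\<lambda>_. 1) \<otimes>\<^bsub>linf_int\<^esub> x) = \<phi> (\<lambda>_. 1) * \<phi> x" using x(1) one by blast
  then show ?thesis using x(2) by (simp add: linf_int_def)
qed

lemma fourier_stieltjes_algebra_hom: "fourier_stieltjes \<in> algebra_hom circle_measure_algebra linf_int"
proof -
  have "fourier_stieltjes \<in> ring_hom circle_measure_algebra linf_int"
  proof (rule ring_hom_memI)
    fix \<mu> assume "\<mu> \<in> carrier circle_measure_algebra"
    then show "fourier_stieltjes \<mu> \<in> carrier linf_int"
      by (simp add: carrier_circle_measure_algebra linf_int_def bounded_fourier_stieltjes)
    fix \<nu> assume "\<nu> \<in> carrier circle_measure_algebra"
    with \<open>\<mu> \<in> carrier circle_measure_algebra\<close>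
    have *: "complex_measure circle_borel \<mu>" "complex_measure circle_borel \<nu>"
      by (simp_all add: carrier_circle_measure_algebra)
    show "fourier_stieltjes (\<mu> \<otimes>\<^bsub>circle_measure_algebra\<^esub> \<nu>) = fourier_stieltjes \<mu> \<otimes>\<^bsub>linf_int\<^esub> fourier_stieltjes \<nu>"
      by (rule ext) (simp add: circle_measure_algebra_def linf_int_def fourier_stieltjes_convolution[OF *])
    show "fourier_stieltjes (\<mu> \<oplus>\<^bsub>circle_measure_algebra\<^esub> \<nu>) = fourier_stieltjes \<mu> \<oplus>\<^bsub>linf_int\<^esub> fourier_stieltjes \<nu>"
      by (rule ext) (simp add: circle_measure_algebra_def linf_int_def fourier_stieltjes_add[OF *])
  next
    show "fourier_stieltjes \<one>\<^bsub>circle_measure_algebra\<^esub> = \<one>\<^bsub>linf_int\<^esub>"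
      by (rule ext) (simp add: circle_measure_algebra_def linf_int_def fourier_stieltjes_dirac)
  qed
  moreover have "fourier_stieltjes (c \<odot>\<^bsub>circle_measure_algebra\<^esub> \<mu>) = c \<odot>\<^bsub>linf_int\<^esub> fourier_stieltjes \<mu>"
    if "\<mu> \<in> carrier circle_measure_algebra" for c \<mu>
  proof (rule ext)
    have "complex_measure circle_borel \<mu>" using that by (simp add: carrier_circle_measure_algebra)
    then show "fourier_stieltjes (c \<odot>\<^bsub>circle_measure_algebra\<^esub> \<mu>) n = (c \<odot>\<^bsub>linf_int\<^esub> fourier_stieltjes \<mu>) n" for n
      by (simp add: circle_measure_algebra_def linf_int_def fourier_stieltjes_cmult)
  qed
  ultimately show ?thesis by (simp add: algebra_hom_def)
qed

text \<open>The algebraic laws are inherited from \<open>\<phi>\<close>. That the composite is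
  nonzero follows from units: the unit mass at 1 is sent to the constant sequence 1, where
  \<open>\<phi>\<close> equals 1.\<close>

lemma dual_map_fourier_stieltjes_character:
  assumes \<phi>: "\<phi> \<in> characters linf_int"
  shows "dual_map circle_measure_algebra fourier_stieltjes \<phi> \<in> characters circle_measure_algebra"
proof -
  let ?A = circle_measure_algebra and ?f = fourier_stieltjes
  let ?F = "dual_map ?A ?f \<phi>"
  have hom: "?f \<in> ring_hom ?A linf_int"
      "\<And>c \<mu>. \<mu> \<in> carrier ?A \<Longrightarrow> ?f (c \<odot>\<^bsub>?A\<^esub> \<mu>) = c \<odot>\<^bsub>linf_int\<^esub> ?f \<mu>"
    using fourier_stieltjes_algebra_hom by (auto simp: algebra_hom_def)
  have closed: "\<mu> \<oplus>\<^bsub>?A\<^esub> \<nu> \<in> carrier ?A" "\<mu> \<otimes>\<^bsub>?A\<^esub> \<nu> \<in> carrier ?A" "c \<odot>\<^bsub>?A\<^esub> \<mu> \<in> carrier ?A"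
    if "\<mu> \<in> carrier ?A" "\<nu> \<in> carrier ?A" for \<mu> \<nu> c
    using that unfolding carrier_circle_measure_algebra
    by (simp_all add: circle_measure_algebra_def complex_measure_add complex_measure_cmult
        complex_measure_convolution)
  have one: "\<one>\<^bsub>?A\<^esub> \<in> carrier ?A"
    unfolding carrier_circle_measure_algebra
    by (simp add: circle_measure_algebra_def complex_measure_dirac)
  have F: "?F \<mu> = \<phi> (?f \<mu>)" if "\<mu> \<in> carrier ?A" for \<mu>
    using that by (simp add: dual_map_def)
  have f: "?f \<mu> \<in> carrier linf_int" if "\<mu> \<in> carrier ?A" for \<mu>
    using ring_hom_closed[OF hom(1) that] .
  have "?F \<one>\<^bsub>?A\<^esub> = 1"
    using ring_hom_one[OF hom(1)] characters_one[OF \<phi>] by (simp add: F[OF one] linf_int_def)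
  then have "\<exists>\<mu>\<in>carrier ?A. ?F \<mu> \<noteq> 0" using one by (intro bexI[of _ "\<one>\<^bsub>?A\<^esub>"]) auto
  moreover have "?F \<in> extensional (carrier ?A)" by (simp add: dual_map_def)
  moreover have "?F (\<mu> \<oplus>\<^bsub>?A\<^esub> \<nu>) = ?F \<mu> + ?F \<nu>" "?F (\<mu> \<otimes>\<^bsub>?A\<^esub> \<nu>) = ?F \<mu> * ?F \<nu>"
      "?F (c \<odot>\<^bsub>?A\<^esub> \<mu>) = c * ?F \<mu>" if "\<mu> \<in> carrier ?A" "\<nu> \<in> carrier ?A" for \<mu> \<nu> c
    using that \<phi> f closed hom
    by (simp_all add: F ring_hom_add[OF hom(1)] ring_hom_mult[OF hom(1)] characters_def)
  ultimately show ?thesis by (simp add: characters_def)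
qed

theorem theorem14:
  "fourier_stieltjes \<in> algebra_hom circle_measure_algebra linf_int \<and>
   dual_map circle_measure_algebra fourier_stieltjes
     \<in> characters linf_int \<rightarrow> characters circle_measure_algebra \<and>
   \<not> inj_on (dual_map circle_measure_algebra fourier_stieltjes) (characters linf_int)"
proof (intro conjI funcsetI)
  show "\<not> inj_on (dual_map circle_measure_algebra fourier_stieltjes) (characters linf_int)"
  proof
    obtain \<Lambda> where \<Lambda>: "generalized_limit \<Lambda>" using generalized_limit_exists by blast
    let ?\<phi> = "iterated_limit \<Lambda> (\<lambda>m n. int n - int m)" and ?\<psi> = "iterated_limit \<Lambda> (\<lambda>m n. int m - int n)"
    assume "inj_on (dual_map circle_measure_algebra fourier_stieltjes) (characters linf_int)"
    moreover have "dual_map circle_measure_algebra fourier_stieltjes ?\<phi>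
        = dual_map circle_measure_algebra fourier_stieltjes ?\<psi>"
      unfolding dual_map_def carrier_circle_measure_algebra
      by (intro restrict_ext) (simp add: iterated_limit_fourier_stieltjes[OF \<Lambda>])
    ultimately have "?\<phi> = ?\<psi>"
      using inj_onD iterated_limit_in_characters[OF \<Lambda>] by metis
    then show False using iterated_limits_neq[OF \<Lambda>] by blast
  qed
qed (rule fourier_stieltjes_algebra_hom, rule dual_map_fourier_stieltjes_character)

end
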